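(* Let $A,B$ be finite alphabets with $\mathrm{Card}(A)>\mathrm{Card}(B)\ge 2$, let $\pi:A^{\mathbb N}\to B^{\mathbb N}$ be the amalgamation map induced by a surjection $\pi:A\to B$, and let $\psi:A^{\mathbb N}\to\mathbb R$ be a Hölder continuous potential with associated Gibbs measure $\mu_\psi$. Then the measure $\mu_\psi\circ\pi^{-1}$ is a Gibbs measure with support $B^{\mathbb N}$, for a potential $\phi:B^{\mathbb N}\to\mathbb R$ such that, for some constants $c,\mathcal D>0$, $$\mathrm{var}_n(\phi)\le \mathcal D\,\exp(-c\sqrt n)\qquad\text{for all } n\in\mathbb N .$$ Furthermore, this potential $\phi$ is normalized (its topological pressure on $B^{\mathbb N}$ is $0$), and it is given by $$\phi(\boldsymbol b)=\lim_{r\to\infty}\lim_{n\to\infty}\log\left(\frac{\mu_{\psi_r}\circ\pi^{-1}[\boldsymbol b_0^n]}{\mu_{\psi_r}\circ\pi^{-1}[\boldsymbol b_1^n]}\right),\qquad \boldsymbol b\in B^{\mathbb N},$$ where $\psi_r$ is the $(r+1)$-symbol approximant of $\psi$ and $\mu_{\psi_r}$ its Gibbs measure. If moreover $\psi$ is locally constant, then there are $\vartheta\in(0,1)$ and $C>0$ such that $\mathrm{var}_n(\phi)\le C\,\vartheta^n$ for all $n\in\mathbb N$.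
   Context: $\mathbb N=\{0,1,2,\dots\}$. For a finite alphabet $A$, $A^{\mathbb N}$ is the space of infinite sequences with the product topology, and $T:A^{\mathbb N}\to A^{\mathbb N}$, $(T\boldsymbol a)_n=\boldsymbol a_{n+1}$, is the shift (similarly on $B^{\mathbb N}$). $\boldsymbol a_m^n$ denotes the word $\boldsymbol a_m\boldsymbol a_{m+1}\cdots\boldsymbol a_n$. For a word $\boldsymbol w$ of length $m+1$, $[\boldsymbol w]=\{\boldsymbol a:\boldsymbol a_0^m=\boldsymbol w\}$ is the cylinder based on $\boldsymbol w$; $\mu[\boldsymbol w]$ is its measure. Amalgamation map: a surjective map $\pi:A\to B$ is extended to $\pi:A^{\mathbb N}\to B^{\mathbb N}$ by $(\pi\boldsymbol a)_n=\pi(\boldsymbol a_n)$. $\mu\circ\pi^{-1}$ is the pushforward measure. A potential is a function $\psi:A^{\mathbb N}\to\mathbb R$. Its variation is $\mathrm{var}_n\psi=\sup\{|\psi(\boldsymbol a)-\psi(\boldsymbol b)|:\boldsymbol a,\boldsymbol b\in A^{\mathbb N},\ \boldsymbol a_0^n=\boldsymbol b_0^n\}$ (same definition on $B^{\mathbb N}$). $\psi$ is Hölder continuous if there are $K>0$ and $\varrho\in(0,1)$ with $\mathrm{var}_n\psi\le K\varrho^n$ for all $n\ge0$. $\psi$ is locally constant if there is $r\in\mathbb N$ such that $\psi(\boldsymbol a)=\psi(\boldsymbol b)$ whenever $\boldsymbol a_0^r=\boldsymbol b_0^r$ (an $(r+1)$-symbol potential). Let $S_n\psi=\sum_{k=0}^{n-1}\psi\circ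 T^k$. A $T$-invariant Borel probability measure $\mu$ is a Gibbs measure for a continuous potential $\psi$ if there are constants $C\ge1$ and $P\in\mathbb R$ such that $$C^{-1}\le\frac{\mu[\boldsymbol a_0^n]}{\exp(S_{n+1}\psi(\boldsymbol a)-(n+1)P)}\le C$$ for all $n\in\mathbb N$ and all $\boldsymbol a$. The constant $P$ is the topological pressure $P(\psi)=\limsup_{n\to\infty}\frac1n\log\sum_{\boldsymbol a:\,T^n\boldsymbol a=\boldsymbol a}\exp(S_n\psi(\boldsymbol a))$; $\psi$ is normalized if $P(\psi)=0$. When $\sum_{n\ge0}\mathrm{var}_n\psi<\infty$ there is a unique Gibbs measure for $\psi$, denoted $\mu_\psi$ (known theorem). The $(r+1)$-symbol approximant of a continuous $\psi$ is $\psi_r(\boldsymbol a)=\max\{\psi(\boldsymbol b):\boldsymbol b\in[\boldsymbol a_0^r]\}$; it is an $(r+1)$-symbol potential, and its Gibbs measure $\mu_{\psi_r}$ is an $r$-step Markov measure. *)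

theory Defs
  imports "HOL-Probability.Probability"
begin

type_synonym 'a sequence = "nat \<Rightarrow> 'a"

text \<open>The alphabet carries the discrete topology, the sequence space the product topology.
  The abstract topologies avoid a type-class topology on the alphabet.\<close>

definition seq_topology :: "'a sequence topology" where
  "seq_topology = product_topology (\<lambda>_. discrete_topology UNIV) UNIV"

definition seq_borel :: "'a sequence measure" where
  "seq_borel = sigma UNIV {U. openin seq_topology U}"

definition shift :: "'a sequence \<Rightarrow> 'a sequence" where
  "shift a = (\<lambda>n. a (Suc n))"

definition amalgamation :: "('a \<Rightarrow> 'b) \<Rightarrow> 'a sequence \<Rightarrow> 'b sequence" where
  "amalgamation \<pi> a = (\<lambda>n. \<pi> (a n))"

text \<open>The letters with indices from \<open>m\<close> to \<open>n\<close>, both included (the empty word if \<open>n < m\<close>).\<close>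

definition word :: "'a sequence \<Rightarrow> nat \<Rightarrow> nat \<Rightarrow> 'a list" where
  "word a m n = map a [m..<Suc n]"

definition cylinder :: "'a list \<Rightarrow> 'a sequence set" where
  "cylinder w = {a. \<forall>i<length w. a i = w ! i}"

text \<open>Extended-real valued, so that the supremum is meaningful (namely infinite) also for
  potentials of unbounded variation.\<close>

definition variation :: "nat \<Rightarrow> ('a sequence \<Rightarrow> real) \<Rightarrow> ereal" where
  "variation n \<psi> = Sup {ereal \<bar>\<psi> a - \<psi> b\<bar> | a b. word a 0 n = word b 0 n}"

definition hoelder_potential :: "('a sequence \<Rightarrow> real) \<Rightarrow> bool" where
  "hoelder_potential \<psi> \<longleftrightarrow>
     (\<exists>K \<rho>. K > 0 \<and> 0 < \<rho> \<and> \<rho> < 1 \<and> (\<forall>n. variation n \<psi> \<le> ereal (K * \<rho> ^ n)))"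

definition locally_constant :: "('a sequence \<Rightarrow> real) \<Rightarrow> bool" where
  "locally_constant \<psi> \<longleftrightarrow> (\<exists>r. \<forall>a b. word a 0 r = word b 0 r \<longrightarrow> \<psi> a = \<psi> b)"

definition birkhoff_sum :: "nat \<Rightarrow> ('a sequence \<Rightarrow> real) \<Rightarrow> 'a sequence \<Rightarrow> real" where
  "birkhoff_sum n \<psi> a = (\<Sum>k<n. \<psi> ((shift ^^ k) a))"

definition shift_invariant :: "'a sequence measure \<Rightarrow> bool" where
  "shift_invariant \<mu> \<longleftrightarrow> distr \<mu> seq_borel shift = \<mu>"

definition gibbs_measure :: "('a sequence \<Rightarrow> real) \<Rightarrow> 'a sequence measure \<Rightarrow> bool" where
  "gibbs_measure \<psi> \<mu> \<longleftrightarrow>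
     continuous_map seq_topology euclideanreal \<psi> \<and>
     prob_space \<mu> \<and> sets \<mu> = sets seq_borel \<and> shift_invariant \<mu> \<and>
     (\<exists>C P. C \<ge> 1 \<and>
        (\<forall>n a. let q = measure \<mu> (cylinder (word a 0 n)) /
                       exp (birkhoff_sum (n + 1) \<psi> a - real (n + 1) * P)
               in 1 / C \<le> q \<and> q \<le> C))"

text \<open>For \<open>n = 0\<close> the index set may be infinite and the term is then \<open>0\<close> by convention; this
  does not affect the upper limit.\<close>

definition pressure :: "('a sequence \<Rightarrow> real) \<Rightarrow> ereal" where
  "pressure \<psi> =
     limsup (\<lambda>n. ereal (1 / real n * ln (\<Sum>a | (shift ^^ n) a = a. exp (birkhoff_sum n \<psi> a))))"

definition normalized :: "('a sequence \<Rightarrow> real) \<Rightarrow> bool" where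
  "normalized \<psi> \<longleftrightarrow> pressure \<psi> = 0"

text \<open>The \<open>(r+1)\<close>-symbol approximant. For continuous \<open>\<psi>\<close> over a finite alphabet the supremum is a
  maximum, as shown by \<open>approximant_attained\<close> below.\<close>

definition approximant :: "nat \<Rightarrow> ('a sequence \<Rightarrow> real) \<Rightarrow> 'a sequence \<Rightarrow> real" where
  "approximant r \<psi> a = (SUP b\<in>cylinder (word a 0 r). \<psi> b)"

definition support :: "'a sequence measure \<Rightarrow> 'a sequence set" where
  "support \<mu> = {a. \<forall>U. openin seq_topology U \<and> a \<in> U \<longrightarrow> measure \<mu> U > 0}"

definition pushforward :: "('a \<Rightarrow> 'b) \<Rightarrow> 'a sequence measure \<Rightarrow> 'b sequence measure" where
  "pushforward \<pi> \<mu> = distr \<mu> seq_borel (amalgamation \<pi>)"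

lemma topspace_seq_topology [simp]: "topspace seq_topology = UNIV"
  by (simp add: seq_topology_def)

lemma sets_seq_borel: "sets seq_borel = sigma_sets UNIV {U. openin seq_topology U}"
  by (simp add: seq_borel_def)

lemma space_seq_borel [simp]: "space seq_borel = UNIV"
  by (simp add: seq_borel_def)

lemma continuous_map_measurable_seq:
  assumes "continuous_map seq_topology seq_topology f"
  shows "f \<in> measurable seq_borel seq_borel"
proof (rule measurable_sigma_sets[OF sets_seq_borel])
  fix U :: "'b sequence set" assume "U \<in> {U. openin seq_topology U}"
  then have "openin seq_topology (f -` U)"
    using openin_continuous_map_preimage[OF assms, of U] by (simp add: vimage_def)
  then show "f -` U \<inter> space seq_borel \<in> sets seq_borel"
    by (auto simp: sets_seq_borel)
qed auto

lemma measurable_shift: "shift \<in> measurable seq_borel seq_borel"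
  by (rule continuous_map_measurable_seq)
    (auto simp: seq_topology_def shift_def continuous_map_componentwise_UNIV
      intro!: continuous_map_product_projection)

lemma measurable_amalgamation: "amalgamation \<pi> \<in> measurable seq_borel seq_borel"
proof (rule continuous_map_measurable_seq)
  have "continuous_map (product_topology (\<lambda>_. discrete_topology UNIV) UNIV)
          (discrete_topology UNIV) (\<pi> \<circ> (\<lambda>a. a n))" for n :: nat
    by (rule continuous_map_compose[OF continuous_map_product_projection]) auto
  then show "continuous_map seq_topology seq_topology (amalgamation \<pi>)"
    by (auto simp: seq_topology_def amalgamation_def continuous_map_componentwise_UNIV o_def)
qed

lemma compactin_cylinder: "compactin seq_topology (cylinder (w :: 'a::finite list))"
proof -
  have "cylinder w = PiE UNIV (\<lambda>i. if i < length w then {w ! i} else UNIV)"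
    by (auto simp: cylinder_def PiE_def Pi_def split: if_splits)
  then show ?thesis
    by (auto simp: seq_topology_def compactin_PiE finite_imp_compactin)
qed

lemma approximant_attained:
  fixes \<psi> :: "'a::finite sequence \<Rightarrow> real"
  assumes "continuous_map seq_topology euclideanreal \<psi>"
  obtains b where "b \<in> cylinder (word a 0 r)" "approximant r \<psi> a = \<psi> b"
    "\<And>b'. b' \<in> cylinder (word a 0 r) \<Longrightarrow> \<psi> b' \<le> \<psi> b"
proof -
  let ?Z = "cylinder (word a 0 r)"
  have "a \<in> ?Z"
    by (auto simp: cylinder_def word_def simp del: upt_Suc)
  moreover have "compact (\<psi> ` ?Z)"
    using image_compactin[OF compactin_cylinder assms] by simp
  ultimately obtain b where b: "b \<in> ?Z" "\<And>b'. b' \<in> ?Z \<Longrightarrow> \<psi> b' \<le> \<psi> b"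
    using compact_attains_sup[of "\<psi> ` ?Z"] by auto
  then have "approximant r \<psi> a = \<psi> b"
    unfolding approximant_def by (intro cSup_eq_maximum) auto
  with b show ?thesis
    using that by blast
qed

end

theory Submission
  imports Defs
begin

text \<open>For sets of letters \<open>S\<^sub>0, \<dots>, S\<^sub>n\<close>, composing the transfer operators restricted to the \<open>S\<^sub>i\<close>
  contracts the projective order of a cone of log-Hoelder functions, at a rate depending only on
  the Hoelder constants of the potential. Hence the ratios of partition functions
  \<open>Z (U\<^sup>M S\<^sub>0 \<dots> S\<^sub>n U\<^sup>N) / Z (U\<^sup>M\<^sup>+\<^sup>n\<^sup>+\<^sup>1\<^sup>+\<^sup>N)\<close>, \<open>U\<close> the whole alphabet, converge exponentially fast; the limit is
  an invariant quasi-Bernoulli function, which every Gibbs measure must equal.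
  Taking fibres of the amalgamation for the \<open>S\<^sub>i\<close>, the same contraction makes the logarithmic
  ratios defining \<open>\<phi>\<close> converge exponentially, uniformly over the approximants, whose Hoelder constants
  are those of the potential. So the variations of \<open>\<phi>\<close> decay exponentially in all cases, which is stronger
  than the stretched exponential bound.\<close>

text \<open>Gibbs bounds hold only up to a constant factor and say nothing about the convergence of
  logarithmic ratios, which needs the exact measures of cylinders. Hence the detour through an
  explicit limit \<open>p\<close> and a proof that the given measures coincide with it. Pointwise
  inequalities \<open>a * G x \<le> F x\<close> survive a positive operator but need not improve.
  What improves is the order in which the differences themselves lie in the cone: such a difference,
  once transferred, is comparable to \<open>G\<close> everywhere, so a fixed share of the gap can be
  absorbed into the bounds. Any letter may precede any other, so one step restricted to a nonempty
  set of letters already gives this comparison. The fibres of the amalgamation therefore raise no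
  mixing problem. The constants are fixed in a locale that knows only \<open>K\<close> and
  \<open>\<rho>\<close>, so that the potential and all its approximants share them. This uniformity
  is what allows the limits in \<open>r\<close> and in \<open>n\<close> to be exchanged.\<close>

definition scons :: "'a \<Rightarrow> 'a sequence \<Rightarrow> 'a sequence" where
  "scons c x = case_nat c x"

lemma scons_0 [simp]: "scons c x 0 = c"
  and scons_Suc [simp]: "scons c x (Suc n) = x n"
  by (simp_all add: scons_def)

lemma shift_scons [simp]: "shift (scons c x) = x"
  by (simp add: shift_def)

definition agree :: "nat \<Rightarrow> 'a sequence \<Rightarrow> 'a sequence \<Rightarrow> bool" where
  "agree n x y \<longleftrightarrow> (\<forall>i<n. x i = y i)"

lemma agree_0 [simp]: "agree 0 x y"
  by (simp add: agree_def)

lemma agree_sym: "agree n x y \<Longrightarrow> agree n y x"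
  by (simp add: agree_def)

lemma agree_scons: "agree n x y \<Longrightarrow> agree (Suc n) (scons c x) (scons c y)"
  by (auto simp: agree_def less_Suc_eq_0_disj)

section \<open>The cone of log-Hoelder functions and the constants of the contraction\<close>

locale hoelder_cone =
  fixes K \<rho> :: real
  assumes K_pos: "K > 0" and rho_pos: "\<rho> > 0" and rho_less_1: "\<rho> < 1"
begin

text \<open>\<open>\<sigma>\<close> is the midpoint of \<open>\<rho>\<close> and 1, and
  \<open>H\<close> solves \<open>K + \<rho> * H = \<sigma> * H\<close>. Then a transfer step narrows
  \<open>cone H\<close> to \<open>cone (\<sigma> * H)\<close>. \<open>\<tau>\<close> is the share
  that may be subtracted inside the narrower cone, \<open>\<theta>\<close> the contraction factor of
  one step, and \<open>D\<close> the quotient of the first upper and lower bounds.\<close>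

definition "H = 2 * K / (1 - \<rho>)"
definition "\<sigma> = (1 + \<rho>) / 2"
definition "\<tau> = exp (- H) * ((1 - \<sigma>) / (1 + \<sigma>))"
definition "\<theta> = 1 - \<tau> * exp (- 2 * H)"
definition "D = exp (4 * H) / \<tau>\<^sup>2"

lemma H_pos: "H > 0"
  using K_pos rho_less_1 by (simp add: H_def)

lemma sigma_pos: "\<sigma> > 0" and sigma_less_1: "\<sigma> < 1"
  using rho_pos rho_less_1 by (simp_all add: \<sigma>_def)

lemma sigma_H: "K + \<rho> * H = \<sigma> * H"
  using rho_less_1 by (simp add: H_def \<sigma>_def field_simps)

lemma tau_pos: "\<tau> > 0" and tau_less_1: "\<tau> < 1"
proof -
  show "\<tau> > 0"
    using sigma_pos sigma_less_1 by (simp add: \<tau>_def)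
  have "exp (- H) * ((1 - \<sigma>) / (1 + \<sigma>)) < 1 * 1"
    using sigma_pos sigma_less_1 H_pos by (intro mult_strict_mono) simp_all
  then show "\<tau> < 1"
    by (simp add: \<tau>_def)
qed

lemma theta_pos: "\<theta> > 0" and theta_less_1: "\<theta> < 1"
proof -
  have "\<tau> * exp (- 2 * H) < 1 * 1"
    using tau_pos tau_less_1 H_pos by (intro mult_strict_mono) simp_all
  then show "\<theta> > 0"
    by (simp add: \<theta>_def)
  show "\<theta> < 1"
    using tau_pos by (simp add: \<theta>_def)
qed

lemma D_pos: "D > 0"
  using tau_pos by (simp add: D_def)

text \<open>This is the inequality that subtraction in the cone demands. The quotient of the two
  differences tends to \<open>(1 - \<sigma>) / (1 + \<sigma>)\<close> as \<open>s\<close> tends to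
  0; the factor \<open>exp (- H)\<close> in \<open>\<tau>\<close> makes the bound hold up to
  \<open>s = H\<close>.\<close>

lemma tau_bound:
  assumes "0 \<le> s" "s \<le> H"
  shows "\<tau> * (exp s - exp (- (\<sigma> * s))) \<le> exp s - exp (\<sigma> * s)"
proof -
  have "1 - (1 + \<sigma>) * s \<le> exp (- ((1 + \<sigma>) * s))"
    using exp_ge_add_one_self[of "- ((1 + \<sigma>) * s)"] by simp
  then have "exp s * (1 - exp (- ((1 + \<sigma>) * s))) \<le> exp H * ((1 + \<sigma>) * s)"
    using assms sigma_pos by (intro mult_mono) auto
  moreover have "exp s * (1 - exp (- ((1 + \<sigma>) * s))) = exp s - exp (- (\<sigma> * s))"
    by (simp add: algebra_simps flip: exp_add)
  ultimately have "\<tau> * (exp s - exp (- (\<sigma> * s))) \<le> \<tau> * (exp H * ((1 + \<sigma>) * s))"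
    using tau_pos by simp
  also have "\<dots> = (exp (- H) * exp H) * (1 - \<sigma>) * s"
    using sigma_pos by (simp add: \<tau>_def del: exp_minus_inverse)
  also have "\<dots> = 1 * ((1 - \<sigma>) * s)"
    by (simp flip: exp_add)
  also have "\<dots> \<le> exp (\<sigma> * s) * (exp ((1 - \<sigma>) * s) - 1)"
    using assms sigma_pos sigma_less_1 exp_ge_add_one_self[of "(1 - \<sigma>) * s"]
    by (intro mult_mono) (auto simp del: exp_ge_add_one_self)
  also have "\<dots> = exp s - exp (\<sigma> * s)"
    by (simp add: algebra_simps flip: exp_add)
  finally show ?thesis .
qed

text \<open>The logarithm of a positive member has oscillation at most \<open>h * \<rho> ^ n\<close>
  once \<open>n\<close> letters are fixed; \<open>n = 0\<close> bounds the global oscillation. The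
  zero function belongs to the cone, so positivity has to be recorded separately.\<close>

definition cone :: "real \<Rightarrow> ('a sequence \<Rightarrow> real) set" where
  "cone h = {F. (\<forall>x. 0 \<le> F x) \<and> (\<forall>n x y. agree n x y \<longrightarrow> F x \<le> exp (h * \<rho> ^ n) * F y)}"

lemma cone_nonneg: "F \<in> cone h \<Longrightarrow> 0 \<le> F x"
  by (simp add: cone_def)

lemma cone_agree: "F \<in> cone h \<Longrightarrow> agree n x y \<Longrightarrow> F x \<le> exp (h * \<rho> ^ n) * F y"
  by (simp add: cone_def)

lemma cone_le: "F \<in> cone h \<Longrightarrow> F x \<le> exp h * F y"
  using cone_agree[of F h 0] by simp

lemma cone_mono:
  assumes "F \<in> cone h" "h \<le> h'"
  shows "F \<in> cone h'"
proof -
  have "exp (h * \<rho> ^ n) * F y \<le> exp (h' * \<rho> ^ n) * F y" for n y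
    using assms cone_nonneg[OF assms(1)] rho_pos by (intro mult_right_mono) auto
  then show ?thesis
    using assms(1) unfolding cone_def by (blast intro: order_trans)
qed

lemma cone_scale: "F \<in> cone h \<Longrightarrow> 0 \<le> t \<Longrightarrow> (\<lambda>x. t * F x) \<in> cone h"
  by (simp add: cone_def mult_left_mono mult.left_commute[of _ t])

lemma cone_sigma: "F \<in> cone (\<sigma> * H) \<Longrightarrow> F \<in> cone H"
  using H_pos sigma_less_1 by (elim cone_mono) simp

lemma cone_one: "0 \<le> h \<Longrightarrow> (\<lambda>_. 1) \<in> cone h"
  using rho_pos by (simp add: cone_def)

text \<open>Each of \<open>F\<close> and \<open>G\<close> varies by a factor of at most
  \<open>exp H\<close>, so their quotient varies by at most \<open>exp (2 * H)\<close>.\<close>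

lemma cone_le_scaled:
  assumes "F \<in> cone H" "G \<in> cone H" "0 < G y"
  shows "exp (- 2 * H) * (F y / G y) * G x \<le> F x"
proof -
  have "(exp (- H) * F y) * (exp (- H) * G x) \<le> F x * G y"
    using cone_le[OF assms(1), of y x] cone_le[OF assms(2), of x y]
      cone_nonneg[OF assms(1)] cone_nonneg[OF assms(2)]
    by (intro mult_mono) (auto simp: exp_minus field_simps)
  moreover have "exp (- 2 * H) = exp (- H) * exp (- H)"
    by (simp flip: exp_add)
  ultimately show ?thesis
    using assms(3) by (simp add: field_simps)
qed

text \<open>This makes \<open>cone (\<sigma> * H)\<close> a set of finite diameter in the projective order of \<open>cone H\<close>.\<close>

lemma cone_diff:
  fixes F G :: "'a sequence \<Rightarrow> real"
  assumes F: "F \<in> cone (\<sigma> * H)" and G: "G \<in> cone (\<sigma> * H)"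
    and t: "0 \<le> t" "\<And>x. t * G x \<le> \<tau> * F x"
  shows "(\<lambda>x. F x - t * G x) \<in> cone H"
  unfolding cone_def
proof (intro CollectI conjI allI impI)
  fix x
  have "\<tau> * F x \<le> 1 * F x"
    using tau_less_1 cone_nonneg[OF F] by (intro mult_right_mono) auto
  with t(2)[of x] show "0 \<le> F x - t * G x"
    by simp
next
  fix n and x y :: "'a sequence" assume xy: "agree n x y"
  define s where "s = H * \<rho> ^ n"
  have s: "0 \<le> s" "s \<le> H"
    using H_pos rho_pos rho_less_1 by (simp_all add: s_def mult_le_cancel_left2 power_le_one)
  have 1: "F x \<le> exp (\<sigma> * s) * F y"
    using cone_agree[OF F xy] by (simp add: s_def mult.assoc)
  have "G y \<le> exp (\<sigma> * s) * G x"
    using cone_agree[OF G agree_sym[OF xy]] by (simp add: s_def mult.assoc)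
  then have "exp (- (\<sigma> * s)) * G y \<le> G x"
    by (simp add: exp_minus field_simps)
  \<comment> \<open>The loss caused by subtracting \<open>t * G\<close> is paid for by the slack
    between the apertures \<open>\<sigma> * H\<close> and \<open>H\<close>.\<close>
  then have "t * (exp s * G y - G x) \<le> t * (exp s * G y - exp (- (\<sigma> * s)) * G y)"
    using t(1) by (intro mult_left_mono) auto
  also have "\<dots> = (t * G y) * (exp s - exp (- (\<sigma> * s)))"
    by (simp add: algebra_simps)
  also have "\<dots> \<le> (\<tau> * F y) * (exp s - exp (- (\<sigma> * s)))"
    using t(2)[of y] sigma_pos s(1) by (intro mult_right_mono) (auto intro: order_trans[of _ 0])
  also have "\<dots> = F y * (\<tau> * (exp s - exp (- (\<sigma> * s))))"
    by simp
  also have "\<dots> \<le> F y * (exp s - exp (\<sigma> * s))"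
    using tau_bound[OF s] cone_nonneg[OF F] by (rule mult_left_mono)
  also have "\<dots> \<le> exp s * F y - F x"
    using 1 by (simp add: algebra_simps)
  finally show "F x - t * G x \<le> exp (H * \<rho> ^ n) * (F y - t * G y)"
    by (simp add: s_def algebra_simps)
qed

end

section \<open>Transfer operators restricted to sets of letters, and their contraction\<close>

text \<open>Agreement on \<open>Suc n\<close> letters corresponds to \<open>variation n\<close>,
  which compares the letters with indices 0 to \<open>n\<close>.\<close>

locale hoelder_transfer = hoelder_cone K \<rho> for K \<rho> :: real +
  fixes \<psi> :: "'a::finite sequence \<Rightarrow> real"
  assumes hoelder: "agree (Suc n) x y \<Longrightarrow> \<bar>\<psi> x - \<psi> y\<bar> \<le> K * \<rho> ^ n"
begin

text \<open>Each operator prepends a letter. In \<open>fold transfer Ss F\<close> the first set of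
  the list therefore constrains the leftmost letter: the past is applied first and the future
  last.\<close>

definition transfer :: "'a set \<Rightarrow> ('a sequence \<Rightarrow> real) \<Rightarrow> 'a sequence \<Rightarrow> real" where
  "transfer S F x = (\<Sum>c\<in>S. exp (\<psi> (scons c x)) * F (scons c x))"

text \<open>Prepending a common letter gains one letter of agreement, which turns \<open>H\<close>
  into \<open>\<rho> * H\<close>; the weight \<open>exp \<psi>\<close> costs \<open>K\<close>. The
  sum is \<open>\<sigma> * H\<close>.\<close>

lemma transfer_cone:
  assumes F: "F \<in> cone H"
  shows "transfer S F \<in> cone (\<sigma> * H)"
  unfolding cone_def
proof (intro CollectI conjI allI impI)
  fix x show "0 \<le> transfer S F x"
    using cone_nonneg[OF F] by (simp add: transfer_def sum_nonneg)
next
  fix n and x y :: "'a sequence" assume xy: "agree n x y"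
  have "exp (\<psi> (scons c x)) * F (scons c x)
      \<le> exp (\<sigma> * H * \<rho> ^ n) * (exp (\<psi> (scons c y)) * F (scons c y))" for c
  proof -
    have xy': "agree (Suc n) (scons c x) (scons c y)"
      using agree_scons[OF xy] .
    have "exp (\<psi> (scons c x)) \<le> exp (K * \<rho> ^ n + \<psi> (scons c y))"
      using hoelder[OF xy'] by simp
    then have "exp (\<psi> (scons c x)) * F (scons c x)
       \<le> exp (K * \<rho> ^ n + \<psi> (scons c y)) * (exp (H * \<rho> ^ Suc n) * F (scons c y))"
      using cone_agree[OF F xy'] cone_nonneg[OF F] by (intro mult_mono) auto
    also have "\<dots> = exp ((K + \<rho> * H) * \<rho> ^ n) * (exp (\<psi> (scons c y)) * F (scons c y))"
      by (simp add: exp_add algebra_simps)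
    finally show ?thesis
      by (simp add: sigma_H)
  qed
  then show "transfer S F x \<le> exp (\<sigma> * H * \<rho> ^ n) * transfer S F y"
    unfolding transfer_def sum_distrib_left by (rule sum_mono)
qed

lemma transfer_pos: "S \<noteq> {} \<Longrightarrow> (\<And>x. 0 < F x) \<Longrightarrow> 0 < transfer S F x"
  by (auto simp: transfer_def intro!: sum_pos)

lemma transfer_diff:
  "transfer S (\<lambda>x. F x - t * G x) = (\<lambda>x. transfer S F x - t * transfer S G x)"
  by (rule ext) (simp add: transfer_def sum_subtractf sum_distrib_left algebra_simps)

lemma transfer_diff':
  "transfer S (\<lambda>x. t * G x - F x) = (\<lambda>x. t * transfer S G x - transfer S F x)"
  by (rule ext) (simp add: transfer_def sum_subtractf sum_distrib_left algebra_simps)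

text \<open>The bounds of \<open>F\<close> between \<open>\<alpha> * G\<close> and
  \<open>\<beta> * G\<close> are meant in the order of \<open>cone H\<close>, not merely
  pointwise.\<close>

definition sandwich :: "real \<Rightarrow> real \<Rightarrow> ('a sequence \<Rightarrow> real) \<Rightarrow> ('a sequence \<Rightarrow> real) \<Rightarrow> bool" where
  "sandwich \<alpha> \<beta> F G \<longleftrightarrow> 0 < \<alpha> \<and> G \<in> cone H \<and> (\<forall>x. 0 < G x) \<and>
     (\<lambda>x. F x - \<alpha> * G x) \<in> cone H \<and> (\<lambda>x. \<beta> * G x - F x) \<in> cone H"

text \<open>The two transferred gaps add up to \<open>\<beta> - \<alpha>\<close> times the
  transferred \<open>G\<close>. From each of them a multiple of that function, proportional to the
  gap at a reference point, can be removed within the cone; together the removed multiples are the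
  share \<open>1 - \<theta>\<close> of \<open>\<beta> - \<alpha>\<close>.\<close>

lemma sandwich_transfer:
  assumes sw: "sandwich \<alpha> \<beta> F G" and S: "S \<noteq> {}"
  obtains \<alpha>' \<beta>' where "\<alpha> \<le> \<alpha>'" "\<beta>' - \<alpha>' \<le> \<theta> * (\<beta> - \<alpha>)"
    "sandwich \<alpha>' \<beta>' (transfer S F) (transfer S G)"
proof -
  define LF LG where "LF = transfer S F" and "LG = transfer S G"
  define F1 F2 where "F1 = (\<lambda>x. LF x - \<alpha> * LG x)" and "F2 = (\<lambda>x. \<beta> * LG x - LF x)"
  have G: "LG \<in> cone (\<sigma> * H)" "\<And>x. 0 < LG x"
    using sw S by (auto simp: sandwich_def LG_def intro: transfer_cone transfer_pos)
  have F1: "F1 \<in> cone (\<sigma> * H)"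
    using sw transfer_cone[of "\<lambda>x. F x - \<alpha> * G x" S]
    by (simp add: sandwich_def transfer_diff F1_def LF_def LG_def)
  have F2: "F2 \<in> cone (\<sigma> * H)"
    using sw transfer_cone[of "\<lambda>x. \<beta> * G x - F x" S]
    by (simp add: sandwich_def transfer_diff' F2_def LF_def LG_def)
  define z :: "'a sequence" where "z = undefined"
  define q1 q2 where "q1 = F1 z / LG z" and "q2 = F2 z / LG z"
  have q: "0 \<le> q1" "0 \<le> q2"
    using G(2)[of z] cone_nonneg[OF F1] cone_nonneg[OF F2] by (auto simp: q1_def q2_def)
  have q_sum: "q1 + q2 = \<beta> - \<alpha>"
    using G(2)[of z] by (simp add: q1_def q2_def F1_def F2_def field_simps)
  define t where "t q = \<tau> * (exp (- 2 * H) * q)" for q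
  have t_nonneg: "0 \<le> t q1" "0 \<le> t q2"
    using q tau_pos by (simp_all add: t_def)
  have "t q1 * LG x \<le> \<tau> * F1 x" for x
    using mult_left_mono[OF cone_le_scaled[OF cone_sigma[OF F1] cone_sigma[OF G(1)] G(2)[of z], of x], of \<tau>] tau_pos
    by (simp add: t_def q1_def mult.assoc)
  then have C1: "(\<lambda>x. F1 x - t q1 * LG x) \<in> cone H"
    using cone_diff[OF F1 G(1)] t_nonneg by blast
  have "t q2 * LG x \<le> \<tau> * F2 x" for x
    using mult_left_mono[OF cone_le_scaled[OF cone_sigma[OF F2] cone_sigma[OF G(1)] G(2)[of z], of x], of \<tau>] tau_pos
    by (simp add: t_def q2_def mult.assoc)
  then have C2: "(\<lambda>x. F2 x - t q2 * LG x) \<in> cone H"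
    using cone_diff[OF F2 G(1)] t_nonneg by blast
  have "t q1 + t q2 = \<tau> * exp (- 2 * H) * (\<beta> - \<alpha>)"
    by (simp add: t_def algebra_simps flip: q_sum)
  then have "(\<beta> - t q2) - (\<alpha> + t q1) \<le> \<theta> * (\<beta> - \<alpha>)"
    by (simp add: \<theta>_def algebra_simps)
  moreover have "sandwich (\<alpha> + t q1) (\<beta> - t q2) LF LG"
    using sw C1 C2 G cone_sigma[OF G(1)] t_nonneg
    by (simp add: sandwich_def F1_def F2_def algebra_simps)
  ultimately show ?thesis
    using that[of "\<alpha> + t q1" "\<beta> - t q2"] t_nonneg by (simp add: LF_def LG_def)
qed

lemma sandwich_fold:
  assumes "sandwich \<alpha> \<beta> F G" "{} \<notin> set Ss"
  shows "\<exists>\<alpha>' \<beta>'. \<alpha> \<le> \<alpha>' \<and> \<beta>' - \<alpha>' \<le> \<theta> ^ length Ss * (\<beta> - \<alpha>) \<and>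
    sandwich \<alpha>' \<beta>' (fold transfer Ss F) (fold transfer Ss G)"
  using assms
proof (induction Ss arbitrary: \<alpha> \<beta> F G)
  case Nil
  then show ?case
    by auto
next
  case (Cons S Ss)
  obtain \<alpha>1 \<beta>1 where 1: "\<alpha> \<le> \<alpha>1" "\<beta>1 - \<alpha>1 \<le> \<theta> * (\<beta> - \<alpha>)"
    "sandwich \<alpha>1 \<beta>1 (transfer S F) (transfer S G)"
    using sandwich_transfer[OF Cons.prems(1), of S] Cons.prems(2) by auto
  obtain \<alpha>2 \<beta>2 where 2: "\<alpha>1 \<le> \<alpha>2" "\<beta>2 - \<alpha>2 \<le> \<theta> ^ length Ss * (\<beta>1 - \<alpha>1)"
    "sandwich \<alpha>2 \<beta>2 (fold transfer Ss (transfer S F)) (fold transfer Ss (transfer S G))"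
    using Cons.IH[OF 1(3)] Cons.prems(2) by auto
  have "\<theta> ^ length Ss * (\<beta>1 - \<alpha>1) \<le> \<theta> ^ length Ss * (\<theta> * (\<beta> - \<alpha>))"
    using 1(2) theta_pos by (intro mult_left_mono) auto
  with 1 2 show ?case
    by (intro exI[of _ \<alpha>2] exI[of _ \<beta>2]) (auto simp: ac_simps)
qed

lemma sandwich_initial:
  fixes F G :: "'a sequence \<Rightarrow> real"
  assumes F: "F \<in> cone (\<sigma> * H)" "\<And>x. 0 < F x" and G: "G \<in> cone (\<sigma> * H)" "\<And>x. 0 < G x"
  obtains \<alpha> \<beta> where "sandwich \<alpha> \<beta> F G" "\<beta> - \<alpha> \<le> D * \<alpha>"
proof -
  define z :: "'a sequence" where "z = undefined"
  define q where "q = F z / G z"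
  have q: "q > 0"
    using F(2)[of z] G(2)[of z] by (simp add: q_def)
  \<comment> \<open>\<open>\<beta>\<close> is the reciprocal of the lower constant obtained with
    \<open>F\<close> and \<open>G\<close> exchanged, and \<open>\<beta> / \<alpha>\<close> is
    \<open>D\<close>.\<close>
  define \<alpha> \<beta> where "\<alpha> = \<tau> * (exp (- 2 * H) * q)" and "\<beta> = exp (2 * H) * q / \<tau>"
  have pos: "\<alpha> > 0" "\<beta> > 0"
    using q tau_pos by (simp_all add: \<alpha>_def \<beta>_def)
  have "\<alpha> * G x \<le> \<tau> * F x" for x
    using mult_left_mono[OF cone_le_scaled[OF cone_sigma[OF F(1)] cone_sigma[OF G(1)] G(2)[of z], of x], of \<tau>] tau_pos
    by (simp add: \<alpha>_def q_def mult.assoc)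
  then have 1: "(\<lambda>x. F x - \<alpha> * G x) \<in> cone H"
    using cone_diff[OF F(1) G(1)] pos by simp
  have "1 / \<beta> * F x \<le> \<tau> * G x" for x
    using mult_left_mono[OF cone_le_scaled[OF cone_sigma[OF G(1)] cone_sigma[OF F(1)] F(2)[of z], of x], of \<tau>] tau_pos
      F(2)[of z] G(2)[of z]
    by (simp add: \<beta>_def q_def exp_minus field_simps)
  then have *: "(\<lambda>x. G x - 1 / \<beta> * F x) \<in> cone H"
    using pos by (intro cone_diff[OF G(1) F(1)]) auto
  have 2: "(\<lambda>x. \<beta> * G x - F x) \<in> cone H"
  proof -
    have "0 \<le> \<beta>"
      using pos by simp
    from cone_scale[OF * this] show ?thesis
      using pos by (simp add: right_diff_distrib)
  qed
  have "D * \<alpha> = \<beta>"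
    using tau_pos by (simp add: D_def \<alpha>_def \<beta>_def power2_eq_square field_simps flip: exp_add)
  with 1 2 show ?thesis
    using that[of \<alpha> \<beta>] pos G cone_sigma[OF G(1)] by (simp add: sandwich_def)
qed

end

section \<open>Partition functions and their limits\<close>

lemma geometric_steps_converge:
  fixes f :: "nat \<Rightarrow> real"
  assumes q: "0 < q" "q < 1" and step: "\<And>n. \<bar>f (Suc n) - f n\<bar> \<le> C * q ^ n"
  shows "\<exists>l. f \<longlonglongrightarrow> l \<and> (\<forall>n. \<bar>f n - l\<bar> \<le> C / (1 - q) * q ^ n)"
proof -
  have C: "0 \<le> C"
    using step[of 0] by simp
  \<comment> \<open>The right-hand side is the exact sum of the geometric steps, which lets the
    induction close.\<close>
  have diff: "\<bar>f (n + k) - f n\<bar> \<le> C / (1 - q) * (q ^ n - q ^ (n + k))" for n k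
  proof (induction k)
    case (Suc k)
    have "C / (1 - q) * (q ^ (n + k) - q ^ (n + Suc k)) = C * q ^ (n + k)"
      using q by (simp add: field_simps)
    with Suc step[of "n + k"]
    have "\<bar>f (n + Suc k) - f n\<bar>
        \<le> C / (1 - q) * (q ^ n - q ^ (n + k)) + C / (1 - q) * (q ^ (n + k) - q ^ (n + Suc k))"
      by simp
    also have "\<dots> = C / (1 - q) * (q ^ n - q ^ (n + Suc k))"
      by (simp only: distrib_left[symmetric]) simp
    finally show ?case .
  qed simp
  have bound: "\<bar>f m - f n\<bar> \<le> C / (1 - q) * q ^ n" if "n \<le> m" for m n
  proof -
    have "C / (1 - q) * (q ^ n - q ^ m) \<le> C / (1 - q) * q ^ n"
      using q C by (intro mult_left_mono) auto
    with diff[of n "m - n"] that show ?thesis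
      by simp
  qed
  have lim0: "(\<lambda>n. C / (1 - q) * q ^ n) \<longlonglongrightarrow> 0"
    using q by (intro tendsto_mult_right_zero LIMSEQ_realpow_zero) auto
  have "Cauchy f"
  proof (rule CauchyI)
    fix e :: real assume "0 < e"
    then obtain M where M: "C / (1 - q) * q ^ n < e / 2" if "n \<ge> M" for n
      using order_tendstoD(2)[OF lim0, of "e / 2"] by (auto simp: eventually_sequentially)
    have "norm (f m - f n) < e" if "m \<ge> M" "n \<ge> M" for m n
      using bound[OF that(1)] bound[OF that(2)] M[OF order_refl] unfolding real_norm_def by linarith
    then show "\<exists>M. \<forall>m\<ge>M. \<forall>n\<ge>M. norm (f m - f n) < e"
      by blast
  qed
  then obtain l where l: "f \<longlonglongrightarrow> l"
    by (auto simp: Cauchy_convergent_iff convergent_def)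
  have "\<bar>f n - l\<bar> \<le> C / (1 - q) * q ^ n" for n
  proof -
    have "(\<lambda>m. \<bar>f m - f n\<bar>) \<longlonglongrightarrow> \<bar>l - f n\<bar>"
      by (intro tendsto_intros l)
    then have "\<bar>l - f n\<bar> \<le> C / (1 - q) * q ^ n"
      by (rule LIMSEQ_le_const2) (use bound in blast)
    then show ?thesis
      by (simp add: abs_minus_commute)
  qed
  with l show ?thesis
    by blast
qed

context hoelder_transfer
begin

lemma fold_cone: "F \<in> cone (\<sigma> * H) \<Longrightarrow> fold transfer Ss F \<in> cone (\<sigma> * H)"
  by (induction Ss arbitrary: F) (auto intro: transfer_cone cone_sigma)

lemma fold_pos: "{} \<notin> set Ss \<Longrightarrow> (\<And>x. 0 < F x) \<Longrightarrow> 0 < fold transfer Ss F x"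
  by (induction Ss arbitrary: F) (auto intro: transfer_pos)

lemma fold_mono: "(\<And>x. F x \<le> G x) \<Longrightarrow> fold transfer Ss F x \<le> fold transfer Ss G x"
proof (induction Ss arbitrary: F G)
  case (Cons S Ss)
  have "transfer S F x \<le> transfer S G x" for x
    using Cons.prems by (auto simp: transfer_def intro!: sum_mono)
  then show ?case
    using Cons.IH by simp
qed simp

lemma fold_scale: "fold transfer Ss (\<lambda>x. t * F x) = (\<lambda>x. t * fold transfer Ss F x)"
proof (induction Ss arbitrary: F)
  case (Cons S Ss)
  have "transfer S (\<lambda>x. t * F x) = (\<lambda>x. t * transfer S F x)"
    by (rule ext) (simp add: transfer_def sum_distrib_left algebra_simps)
  then show ?case
    using Cons.IH by simp
qed simp

lemma fold_sum: "fold transfer Ss (\<lambda>x. \<Sum>i\<in>I. F i x) = (\<lambda>x. \<Sum>i\<in>I. fold transfer Ss (F i) x)"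
proof (induction Ss arbitrary: F)
  case (Cons S Ss)
  have "transfer S (\<lambda>x. \<Sum>i\<in>I. F i x) = (\<lambda>x. \<Sum>i\<in>I. transfer S (F i) x)"
    by (rule ext) (simp add: transfer_def sum_distrib_left sum.swap[of _ S])
  then show ?case
    using Cons.IH by simp
qed simp

text \<open>The lower factor never decreases, so the gap relative to it is at most
  \<open>D * \<theta> ^ length Ss\<close>; \<open>ln x \<le> x - 1\<close> turns this into a
  logarithmic bound.\<close>

lemma contraction:
  fixes F G :: "'a sequence \<Rightarrow> real"
  assumes F: "F \<in> cone (\<sigma> * H)" "\<And>x. 0 < F x" and G: "G \<in> cone (\<sigma> * H)" "\<And>x. 0 < G x"
    and Ss: "{} \<notin> set Ss"
  obtains a b where "0 < a" "0 < b" "ln b - ln a \<le> D * \<theta> ^ length Ss"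
    "\<forall>x. a * fold transfer Ss G x \<le> fold transfer Ss F x"
    "\<forall>x. fold transfer Ss F x \<le> b * fold transfer Ss G x"
proof -
  obtain \<alpha> \<beta> where ab: "sandwich \<alpha> \<beta> F G" "\<beta> - \<alpha> \<le> D * \<alpha>"
    using sandwich_initial[OF F G] .
  obtain a b where 1: "\<alpha> \<le> a" "b - a \<le> \<theta> ^ length Ss * (\<beta> - \<alpha>)"
    "sandwich a b (fold transfer Ss F) (fold transfer Ss G)"
    using sandwich_fold[OF ab(1) Ss] by blast
  have a: "0 < a"
    and le: "a * fold transfer Ss G x \<le> fold transfer Ss F x"
      "fold transfer Ss F x \<le> b * fold transfer Ss G x" for x
    using 1(3) by (auto simp: sandwich_def dest: cone_nonneg)
  have pos: "0 < fold transfer Ss G undefined"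
    using G(2) Ss by (rule fold_pos[rotated])
  have "a * fold transfer Ss G undefined \<le> b * fold transfer Ss G undefined"
    using le[of undefined] by simp
  then have "a \<le> b"
    using pos by simp
  with a have b: "0 < b"
    by simp
  have "ln b - ln a \<le> b / a - 1"
    using ln_add_one_self_le_self2[of "b / a - 1"] a b by (simp add: ln_div)
  also have "\<dots> \<le> \<theta> ^ length Ss * (\<beta> - \<alpha>) / a"
    using divide_right_mono[OF 1(2), of a] a by (simp add: diff_divide_distrib)
  also have "\<dots> \<le> \<theta> ^ length Ss * (D * a) / a"
    using ab(2) 1(1) a theta_pos D_pos
    by (intro divide_right_mono mult_left_mono)
      (auto intro: order_trans[OF _ mult_left_mono[of \<alpha> a D]])
  also have "\<dots> = D * \<theta> ^ length Ss"
    using a by simp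
  finally show ?thesis
    using that a b le by blast
qed

text \<open>After the common block \<open>Ss\<close> the quotient of the two functions lies in a
  short interval at every point. Positive operators keep it there, whatever the continuation and the
  evaluation point. All later estimates of memory loss are instances of this.\<close>

lemma contraction_append:
  fixes F G :: "'a sequence \<Rightarrow> real"
  assumes F: "F \<in> cone (\<sigma> * H)" "\<And>x. 0 < F x" and G: "G \<in> cone (\<sigma> * H)" "\<And>x. 0 < G x"
    and Ss: "{} \<notin> set Ss" "{} \<notin> set Ts" "{} \<notin> set Ts'"
  shows "\<bar>(ln (fold transfer (Ss @ Ts) F x) - ln (fold transfer (Ss @ Ts) G x)) -
     (ln (fold transfer (Ss @ Ts') F y) - ln (fold transfer (Ss @ Ts') G y))\<bar> \<le> D * \<theta> ^ length Ss"
proof -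
  obtain a b where ab: "0 < a" "0 < b" "ln b - ln a \<le> D * \<theta> ^ length Ss"
    and le: "\<forall>x. a * fold transfer Ss G x \<le> fold transfer Ss F x"
    "\<forall>x. fold transfer Ss F x \<le> b * fold transfer Ss G x"
    using contraction[OF F G Ss(1)] .
  have "ln (fold transfer (Ss @ Rs) F x) - ln (fold transfer (Ss @ Rs) G x) \<in> {ln a..ln b}"
    if Rs: "{} \<notin> set Rs" for Rs x
  proof -
    have pos: "0 < fold transfer (Ss @ Rs) F x" "0 < fold transfer (Ss @ Rs) G x"
      using F(2) G(2) Rs Ss(1) by (auto intro!: fold_pos simp del: fold_append)
    have "a * fold transfer (Ss @ Rs) G x \<le> fold transfer (Ss @ Rs) F x"
    proof -
      have "fold transfer Rs (\<lambda>x. a * fold transfer Ss G x) x \<le> fold transfer Rs (fold transfer Ss F) x"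
        using le(1) by (intro fold_mono) auto
      then show ?thesis
        by (simp add: fold_scale)
    qed
    then have "ln (a * fold transfer (Ss @ Rs) G x) \<le> ln (fold transfer (Ss @ Rs) F x)"
      using pos ab(1) by (subst ln_le_cancel_iff) auto
    moreover have "fold transfer (Ss @ Rs) F x \<le> b * fold transfer (Ss @ Rs) G x"
    proof -
      have "fold transfer Rs (fold transfer Ss F) x \<le> fold transfer Rs (\<lambda>x. b * fold transfer Ss G x) x"
        using le(2) by (intro fold_mono) auto
      then show ?thesis
        by (simp add: fold_scale)
    qed
    then have "ln (fold transfer (Ss @ Rs) F x) \<le> ln (b * fold transfer (Ss @ Rs) G x)"
      using pos ab(2) by (subst ln_le_cancel_iff) auto
    ultimately show ?thesis
      using pos ab by (simp add: ln_mult del: fold_append)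
  qed
  from this[OF Ss(2), of x] this[OF Ss(3), of y] ab(3) show ?thesis
    unfolding atLeastAtMost_iff by linarith
qed

text \<open>The boundary tail \<open>undefined\<close> is an arbitrary fixed point; another tail
  would change the value by a factor of at most \<open>exp H\<close>.\<close>

definition Z :: "'a set list \<Rightarrow> real" where
  "Z Ss = fold transfer Ss (\<lambda>_. 1) undefined"

abbreviation full :: "nat \<Rightarrow> 'a set list" where
  "full n \<equiv> replicate n UNIV"

lemma one_cone: "(\<lambda>_. 1) \<in> cone (\<sigma> * H)"
  using sigma_pos H_pos by (intro cone_one) simp

lemma Z_pos: "{} \<notin> set Ss \<Longrightarrow> 0 < Z Ss"
  by (simp add: Z_def fold_pos)

lemma Z_split: "Z (Ss @ S # Ts) = (\<Sum>c\<in>S. Z (Ss @ {c} # Ts))"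
proof -
  have "transfer S F = (\<lambda>x. \<Sum>c\<in>S. transfer {c} F x)" for F
    by (rule ext) (simp add: transfer_def)
  then show ?thesis
    by (simp add: Z_def fold_sum)
qed

text \<open>The function produced by \<open>Ss\<close> varies by a factor of at most
  \<open>exp H\<close> and may be replaced by a constant before \<open>Ts\<close> is
  applied.\<close>

lemma Z_append_le: "Z (Ss @ Ts) \<le> exp H * Z Ss * Z Ts"
proof -
  have "fold transfer Ss (\<lambda>_. 1) \<in> cone H"
    using fold_cone[OF one_cone] by (rule cone_sigma)
  from cone_le[OF this, of _ undefined]
  have "fold transfer Ts (fold transfer Ss (\<lambda>_. 1)) undefined
     \<le> fold transfer Ts (\<lambda>x. exp H * Z Ss * 1) undefined"
    by (intro fold_mono) (simp add: Z_def)
  then show ?thesis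
    by (subst (asm) fold_scale) (simp add: Z_def)
qed

lemma Z_append_ge: "exp (- H) * Z Ss * Z Ts \<le> Z (Ss @ Ts)"
proof -
  have "fold transfer Ss (\<lambda>_. 1) \<in> cone H"
    using fold_cone[OF one_cone] by (rule cone_sigma)
  from cone_le[OF this, of undefined]
  have "fold transfer Ts (\<lambda>x. exp (- H) * Z Ss * 1) undefined
    \<le> fold transfer Ts (fold transfer Ss (\<lambda>_. 1)) undefined"
    by (intro fold_mono) (simp add: Z_def exp_minus field_simps)
  then show ?thesis
    by (subst (asm) fold_scale) (simp add: Z_def)
qed

section \<open>Ratios over finite windows and their limit\<close>

definition Q :: "nat \<Rightarrow> nat \<Rightarrow> 'a set list \<Rightarrow> real" where
  "Q M N Ss = Z (full M @ Ss @ full N) / Z (full (M + length Ss + N))"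

lemma full_nonempty: "{} \<notin> set (full n)"
  by auto

lemma Q_pos: "{} \<notin> set Ss \<Longrightarrow> 0 < Q M N Ss"
  by (auto simp: Q_def intro!: divide_pos_pos Z_pos)

lemma ln_Q:
  "{} \<notin> set Ss \<Longrightarrow> ln (Q M N Ss) = ln (Z (full M @ Ss @ full N)) - ln (Z (full (M + length Ss + N)))"
  unfolding Q_def by (intro ln_divide_pos Z_pos) auto

lemma transfer_pos_cone:
  assumes "F \<in> cone (\<sigma> * H)" "\<And>x. 0 < F x" "S \<noteq> {}"
  shows "transfer S F \<in> cone (\<sigma> * H)" "\<And>x. 0 < transfer S F x"
  using assms by (auto intro: transfer_cone cone_sigma transfer_pos)

text \<open>One more letter in the far past changes the initial function from 1 to
  \<open>transfer UNIV\<close> of 1. Numerator and denominator then share the block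
  \<open>full M\<close> and differ only in what follows it.\<close>

lemma Q_Suc_past:
  assumes Ss: "{} \<notin> set Ss"
  shows "\<bar>ln (Q (Suc M) N Ss) - ln (Q M N Ss)\<bar> \<le> D * \<theta> ^ M"
proof -
  have 1: "Z (full (Suc M) @ Ss @ full N) =
      fold transfer (full M @ Ss @ full N) (transfer UNIV (\<lambda>_. 1)) undefined"
    by (simp add: Z_def)
  have 2: "Z (full (Suc M + length Ss + N)) =
      fold transfer (full M @ full (length Ss + N)) (transfer UNIV (\<lambda>_. 1)) undefined"
    by (simp add: Z_def ac_simps flip: replicate_add fold_append)
  have 3: "Z (full (M + length Ss + N)) =
      fold transfer (full M @ full (length Ss + N)) (\<lambda>_. 1) undefined"
    by (simp add: Z_def ac_simps flip: replicate_add fold_append)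
  have "\<bar>(ln (fold transfer (full M @ Ss @ full N) (transfer UNIV (\<lambda>_. 1)) undefined)
      - ln (fold transfer (full M @ Ss @ full N) (\<lambda>_. 1) undefined))
    - (ln (fold transfer (full M @ full (length Ss + N)) (transfer UNIV (\<lambda>_. 1)) undefined)
      - ln (fold transfer (full M @ full (length Ss + N)) (\<lambda>_. 1) undefined))\<bar>
    \<le> D * \<theta> ^ length (full M)"
    using Ss by (intro contraction_append transfer_pos_cone one_cone) auto
  then show ?thesis
    unfolding ln_Q[OF Ss] 1 2 3 Z_def[of "full M @ Ss @ full N"] by (simp del: fold_append)
qed

text \<open>Here numerator and denominator are the two initial functions, compared after the common
  block \<open>full N\<close> with and without one further step.\<close>

lemma Q_Suc_future:
  assumes Ss: "{} \<notin> set Ss"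
  shows "\<bar>ln (Q M (Suc N) Ss) - ln (Q M N Ss)\<bar> \<le> D * \<theta> ^ N"
proof -
  define F G where "F = fold transfer (full M @ Ss) (\<lambda>_. 1)"
    and "G = fold transfer (full (M + length Ss)) (\<lambda>_. 1)"
  have FG: "F \<in> cone (\<sigma> * H)" "G \<in> cone (\<sigma> * H)" "\<And>x. 0 < F x" "\<And>x. 0 < G x"
    using Ss by (auto simp: F_def G_def intro!: fold_cone one_cone fold_pos
        simp del: fold_append fold_replicate)
  have *: "full (M + length Ss + n) = full (M + length Ss) @ full n" for n
    by (simp add: replicate_add)
  have 1: "Z (full M @ Ss @ full n) = fold transfer (full n) F undefined"
    "Z (full (M + length Ss + n)) = fold transfer (full n) G undefined" for n
    unfolding * by (simp_all add: Z_def F_def G_def)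
  have 2: "full (Suc N) = full N @ [UNIV]"
    by (simp add: replicate_append_same)
  have "\<bar>(ln (fold transfer (full N @ [UNIV]) F undefined)
      - ln (fold transfer (full N @ [UNIV]) G undefined))
    - (ln (fold transfer (full N @ []) F undefined)
      - ln (fold transfer (full N @ []) G undefined))\<bar> \<le> D * \<theta> ^ length (full N)"
    using FG by (intro contraction_append) auto
  then show ?thesis
    unfolding ln_Q[OF Ss] 1 unfolding 2 by (simp del: fold_append fold_replicate)
qed

text \<open>The candidate for the Gibbs measure of the set of sequences whose letters lie
  successively in the sets of \<open>Ss\<close>.\<close>

definition p :: "'a set list \<Rightarrow> real" where
  "p Ss = lim (\<lambda>k. Q k k Ss)"

lemma
  assumes Ss: "{} \<notin> set Ss"
  shows Q_tendsto: "(\<lambda>k. Q k k Ss) \<longlonglongrightarrow> p Ss" and p_pos: "0 < p Ss"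
    and Q_rate: "\<bar>ln (Q k k Ss) - ln (p Ss)\<bar> \<le> 2 * D / (1 - \<theta>) * \<theta> ^ k"
proof -
  have "\<bar>ln (Q (Suc k) (Suc k) Ss) - ln (Q k k Ss)\<bar> \<le> (2 * D) * \<theta> ^ k" for k
    using Q_Suc_past[OF Ss, of k "Suc k"] Q_Suc_future[OF Ss, of k k] by simp
  from geometric_steps_converge[OF theta_pos theta_less_1 this]
  obtain l where l: "(\<lambda>k. ln (Q k k Ss)) \<longlonglongrightarrow> l"
    "\<And>k. \<bar>ln (Q k k Ss) - l\<bar> \<le> 2 * D / (1 - \<theta>) * \<theta> ^ k"
    by blast
  have *: "(\<lambda>k. Q k k Ss) \<longlonglongrightarrow> exp l"
    using tendsto_exp[OF l(1)] by (simp add: Q_pos[OF Ss])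
  then have eq: "p Ss = exp l"
    unfolding p_def by (rule limI)
  show "(\<lambda>k. Q k k Ss) \<longlonglongrightarrow> p Ss" "0 < p Ss"
    "\<bar>ln (Q k k Ss) - ln (p Ss)\<bar> \<le> 2 * D / (1 - \<theta>) * \<theta> ^ k"
    using * l(2) by (simp_all add: eq)
qed

text \<open>A window shifted by one has the same limit; this yields invariance when
  \<open>UNIV\<close> is added at either end.\<close>

lemma
  assumes Ss: "{} \<notin> set Ss"
  shows Q_past_tendsto: "(\<lambda>k. Q (Suc k) k Ss) \<longlonglongrightarrow> p Ss"
    and Q_future_tendsto: "(\<lambda>k. Q k (Suc k) Ss) \<longlonglongrightarrow> p Ss"
proof -
  have lim0: "(\<lambda>k. D * \<theta> ^ k) \<longlonglongrightarrow> 0"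
    using theta_pos theta_less_1 by (intro tendsto_mult_right_zero LIMSEQ_realpow_zero) auto
  have lnQ: "(\<lambda>k. ln (Q k k Ss)) \<longlonglongrightarrow> ln (p Ss)"
    using p_pos[OF Ss] by (intro tendsto_ln Q_tendsto Ss) auto
  have gen: "(\<lambda>k. R k) \<longlonglongrightarrow> p Ss"
    if R: "\<And>k. \<bar>ln (R k) - ln (Q k k Ss)\<bar> \<le> D * \<theta> ^ k" "\<And>k. 0 < R k" for R
  proof -
    have "(\<lambda>k. ln (R k) - ln (Q k k Ss)) \<longlonglongrightarrow> 0"
      by (rule Lim_null_comparison[OF _ lim0]) (use R in simp)
    from tendsto_exp[OF tendsto_add[OF this lnQ]] show ?thesis
      using p_pos[OF Ss] R(2) by simp
  qed
  show "(\<lambda>k. Q (Suc k) k Ss) \<longlonglongrightarrow> p Ss" "(\<lambda>k. Q k (Suc k) Ss) \<longlonglongrightarrow> p Ss"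
    using Q_Suc_past[OF Ss] Q_Suc_future[OF Ss] Q_pos[OF Ss] by (auto intro: gen)
qed

lemma p_Nil [simp]: "p [] = 1"
proof -
  have "Z (full n) \<noteq> 0" for n
    using Z_pos[OF full_nonempty[of n]] by simp
  then have "Q k k [] = 1" for k
    by (simp add: Q_def flip: replicate_add)
  then have "(\<lambda>k. Q k k []) \<longlonglongrightarrow> 1"
    by simp
  then show ?thesis
    unfolding p_def by (rule limI)
qed

lemma p_split:
  assumes "{} \<notin> set Ss" "{} \<notin> set Ts" "S \<noteq> {}"
  shows "p (Ss @ S # Ts) = (\<Sum>c\<in>S. p (Ss @ {c} # Ts))"
proof -
  have "Q k k (Ss @ S # Ts) = (\<Sum>c\<in>S. Q k k (Ss @ {c} # Ts))" for k
    using Z_split[of "full k @ Ss" S "Ts @ full k"]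
    by (simp add: Q_def sum_divide_distrib)
  then have "(\<lambda>k. Q k k (Ss @ S # Ts)) \<longlonglongrightarrow> (\<Sum>c\<in>S. p (Ss @ {c} # Ts))"
    using assms by (auto intro!: tendsto_sum Q_tendsto)
  then show ?thesis
    unfolding p_def by (rule limI)
qed

lemma p_snoc_UNIV:
  assumes "{} \<notin> set Ss"
  shows "p (Ss @ [UNIV]) = p Ss"
proof -
  have "Q k k (Ss @ [UNIV]) = Q k (Suc k) Ss" for k
    by (simp add: Q_def)
  then have "(\<lambda>k. Q k k (Ss @ [UNIV])) \<longlonglongrightarrow> p Ss"
    using Q_future_tendsto[OF assms] by simp
  then show ?thesis
    unfolding p_def by (rule limI)
qed

lemma p_Cons_UNIV:
  assumes "{} \<notin> set Ss"
  shows "p (UNIV # Ss) = p Ss"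
proof -
  have "Q k k (UNIV # Ss) = Q (Suc k) k Ss" for k
    by (simp add: Q_def replicate_app_Cons_same)
  then have "(\<lambda>k. Q k k (UNIV # Ss)) \<longlonglongrightarrow> p Ss"
    using Q_past_tendsto[OF assms] by simp
  then show ?thesis
    unfolding p_def by (rule limI)
qed

text \<open>The window is cut at both ends of \<open>Ss\<close> in the numerator and in the
  denominator. Each of the four cuts costs \<open>exp H\<close>, and the factors
  \<open>Z (full k)\<close> cancel.\<close>

lemma
  assumes Ss: "{} \<notin> set Ss"
  shows p_le: "p Ss \<le> exp (4 * H) * (Z Ss / Z (full (length Ss)))"
    and p_ge: "exp (- 4 * H) * (Z Ss / Z (full (length Ss))) \<le> p Ss"
proof -
  let ?n = "length Ss"
  have Zp: "0 < Z (full m)" for m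
    by (auto intro: Z_pos)
  have ZSs: "0 < Z Ss"
    using Ss by (rule Z_pos)
  have up: "Z (full k @ Ts @ full k) \<le> exp (2 * H) * (Z (full k) * Z Ts * Z (full k))"
    if "{} \<notin> set Ts" for k Ts
  proof -
    have e2: "exp (2 * H) = exp H * exp H"
      by (simp flip: exp_add)
    have "Z (full k @ Ts @ full k) \<le> exp H * Z (full k) * Z (Ts @ full k)"
      by (rule Z_append_le)
    also have "\<dots> \<le> exp H * Z (full k) * (exp H * Z Ts * Z (full k))"
      using Zp[of k] by (intro mult_left_mono Z_append_le) auto
    also have "\<dots> = exp (2 * H) * (Z (full k) * Z Ts * Z (full k))"
      unfolding e2 by (simp only: mult_ac)
    finally show ?thesis .
  qed
  have lo: "exp (- 2 * H) * (Z (full k) * Z Ts * Z (full k)) \<le> Z (full k @ Ts @ full k)"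
    if "{} \<notin> set Ts" for k Ts
  proof -
    have e2: "exp (- 2 * H) = exp (- H) * exp (- H)"
      by (simp flip: exp_add)
    have "exp (- 2 * H) * (Z (full k) * Z Ts * Z (full k))
      = exp (- H) * Z (full k) * (exp (- H) * Z Ts * Z (full k))"
      unfolding e2 by (simp only: mult_ac)
    also have "\<dots> \<le> exp (- H) * Z (full k) * Z (Ts @ full k)"
      using Zp[of k] by (intro mult_left_mono Z_append_ge) auto
    also have "\<dots> \<le> Z (full k @ Ts @ full k)"
      by (rule Z_append_ge)
    finally show ?thesis .
  qed
  have full3: "full (k + ?n + k) = full k @ full ?n @ full k" for k
    by (simp add: replicate_add)
  have "Q k k Ss \<le> exp (4 * H) * (Z Ss / Z (full ?n))" for k
  proof -
    have "Q k k Ss \<le> (exp (2 * H) * (Z (full k) * Z Ss * Z (full k)))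
      / (exp (- 2 * H) * (Z (full k) * Z (full ?n) * Z (full k)))"
      unfolding Q_def full3 using up[OF Ss] lo[OF full_nonempty] Zp ZSs
      by (intro frac_le) (auto simp: less_imp_le)
    also have "\<dots> = exp (2 * H) / exp (- 2 * H) * (Z Ss / Z (full ?n))"
      using Zp[of k] Zp[of ?n] by (simp add: field_simps)
    finally show ?thesis
      by (simp flip: exp_diff)
  qed
  then show "p Ss \<le> exp (4 * H) * (Z Ss / Z (full ?n))"
    by (intro LIMSEQ_le_const2[OF Q_tendsto[OF Ss]]) blast
  have "exp (- 4 * H) * (Z Ss / Z (full ?n)) \<le> Q k k Ss" for k
  proof -
    have "(exp (- 2 * H) * (Z (full k) * Z Ss * Z (full k)))
      / (exp (2 * H) * (Z (full k) * Z (full ?n) * Z (full k))) \<le> Q k k Ss"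
      unfolding Q_def full3 using lo[OF Ss] up[OF full_nonempty] Zp ZSs Z_pos[of "full k @ full ?n @ full k"]
        Z_pos[of "full k @ Ss @ full k"] Ss
      by (intro frac_le) (auto intro!: less_imp_le)
    also have "(exp (- 2 * H) * (Z (full k) * Z Ss * Z (full k)))
      / (exp (2 * H) * (Z (full k) * Z (full ?n) * Z (full k)))
       = exp (- 2 * H) / exp (2 * H) * (Z Ss / Z (full ?n))"
      using Zp[of k] Zp[of ?n] by (simp add: field_simps)
    finally show ?thesis
      by (simp flip: exp_diff)
  qed
  then show "exp (- 4 * H) * (Z Ss / Z (full ?n)) \<le> p Ss"
    by (intro LIMSEQ_le_const[OF Q_tendsto[OF Ss]]) blast
qed

text \<open>The quasi-Bernoulli bound. The exponent 14 is three comparisons of \<open>p\<close> with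
  \<open>Z\<close> at 4 each, plus one cut in the numerator and one in the denominator.\<close>

lemma p_append_ge:
  assumes Ss: "{} \<notin> set Ss" and Ts: "{} \<notin> set Ts"
  shows "exp (- 14 * H) * p Ss * p Ts \<le> p (Ss @ Ts)"
proof -
  let ?z = "\<lambda>Ss. Z Ss / Z (full (length Ss))"
  have pos: "0 < Z (full n)" "0 < Z Ss" "0 < Z Ts" for n
    using Ss Ts by (auto intro: Z_pos)
  have "p Ss * p Ts \<le> (exp (4 * H) * ?z Ss) * (exp (4 * H) * ?z Ts)"
    using Ss Ts pos p_pos[OF Ts] by (intro mult_mono p_le) (auto simp: less_imp_le)
  then have "exp (- 14 * H) * (p Ss * p Ts) \<le>
      exp (- 14 * H) * ((exp (4 * H) * ?z Ss) * (exp (4 * H) * ?z Ts))"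
    by (rule mult_left_mono) simp
  also have "\<dots> = (exp (- 14 * H) * (exp (4 * H) * exp (4 * H))) * (?z Ss * ?z Ts)"
    by (simp only: mult_ac)
  also have "exp (- 14 * H) * (exp (4 * H) * exp (4 * H)) = exp (- 4 * H) * (exp (- H) / exp H)"
    by (simp flip: exp_add exp_diff)
  also have "\<dots> * (?z Ss * ?z Ts) = exp (- 4 * H) * ((exp (- H) * Z Ss * Z Ts)
      / (exp H * Z (full (length Ss)) * Z (full (length Ts))))"
    by (simp add: mult_ac)
  also have "\<dots> \<le> exp (- 4 * H) * ?z (Ss @ Ts)"
  proof (intro mult_left_mono frac_le)
    show "exp (- H) * Z Ss * Z Ts \<le> Z (Ss @ Ts)"
      by (rule Z_append_ge)
    show "Z (full (length (Ss @ Ts))) \<le> exp H * Z (full (length Ss)) * Z (full (length Ts))"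
      using Z_append_le[of "full (length Ss)" "full (length Ts)"] by (simp add: replicate_add)
  qed (use pos Z_pos[of "Ss @ Ts"] Ss Ts in \<open>auto intro: less_imp_le\<close>)
  also have "\<dots> \<le> p (Ss @ Ts)"
    using p_ge[of "Ss @ Ts"] Ss Ts by simp
  finally show ?thesis
    by (simp add: mult.assoc)
qed

text \<open>The logarithmic weight of a first letter given what follows forgets everything beyond
  the block \<open>Ss\<close>. With \<open>S\<close> in front, the function \<open>G\<close> built
  from the past becomes \<open>transfer S G\<close>, and \<open>Ss\<close> is the common
  block.\<close>

lemma p_ratio:
  assumes ne: "S \<noteq> {}" "{} \<notin> set Ss" "{} \<notin> set Ts" "{} \<notin> set Ts'"
  shows "\<bar>(ln (p (S # Ss @ Ts)) - ln (p (Ss @ Ts))) - (ln (p (S # Ss @ Ts')) - ln (p (Ss @ Ts')))\<bar>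
    \<le> D * \<theta> ^ length Ss"
proof -
  define f where "f k Rs = (ln (Q k k (S # Ss @ Rs)) - ln (Q k k (Ss @ Rs)))" for k Rs
  have lim: "(\<lambda>k. f k Rs) \<longlonglongrightarrow> ln (p (S # Ss @ Rs)) - ln (p (Ss @ Rs))" if "{} \<notin> set Rs" for Rs
  proof -
    have "{} \<notin> set (S # Ss @ Rs)" "{} \<notin> set (Ss @ Rs)"
      using ne that by auto
    from this[THEN p_pos] this[THEN Q_tendsto] show ?thesis
      unfolding f_def by (intro tendsto_intros) auto
  qed
  have "\<bar>f k Ts - f k Ts'\<bar> \<le> D * \<theta> ^ length Ss + D * \<theta> ^ k" for k
  proof -
    define G where "G = fold transfer (full k) (\<lambda>_. 1)"
    have G: "G \<in> cone (\<sigma> * H)" "\<And>x. 0 < G x"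
      by (auto simp: G_def intro!: fold_cone one_cone fold_pos simp del: fold_replicate)
    define g where "g Rs = ln (fold transfer (Ss @ Rs @ full k) (transfer S G) undefined)
      - ln (fold transfer (Ss @ Rs @ full k) G undefined)" for Rs
    define h where "h n = ln (Z (full (Suc (k + n)))) - ln (Z (full (k + n)))" for n
    have f_eq: "f k Rs = g Rs - h (length Ss + length Rs + k)" if "{} \<notin> set Rs" for Rs
    proof -
      have "{} \<notin> set (S # Ss @ Rs)" "{} \<notin> set (Ss @ Rs)"
        using ne that by auto
      then show ?thesis
        unfolding f_def by (subst (1 2) ln_Q) (auto simp: g_def h_def Z_def G_def ac_simps)
    qed
    have g: "\<bar>g Ts - g Ts'\<bar> \<le> D * \<theta> ^ length Ss"
      unfolding g_def using ne G by (intro contraction_append transfer_pos_cone) auto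
    \<comment> \<open>The normalizing factors have different lengths for \<open>Ts\<close> and
      \<open>Ts'\<close>; their effect vanishes as the window grows.\<close>
    have h: "\<bar>h m - h n\<bar> \<le> D * \<theta> ^ k" for m n
    proof -
      have h_eq: "h n = ln (fold transfer (full k @ full n) (transfer UNIV (\<lambda>_. 1)) undefined)
        - ln (fold transfer (full k @ full n) (\<lambda>_. 1) undefined)" for n
        by (simp add: h_def Z_def flip: replicate_add fold_append)
      have "\<bar>h m - h n\<bar> \<le> D * \<theta> ^ length (full k)"
        unfolding h_eq by (intro contraction_append transfer_pos_cone one_cone) auto
      then show ?thesis
        by simp
    qed
    show ?thesis
      using g h[of "length Ss + length Ts + k" "length Ss + length Ts' + k"] ne
      by (simp add: f_eq)
  qed
  moreover have "(\<lambda>k. D * \<theta> ^ length Ss + D * \<theta> ^ k) \<longlonglongrightarrow> D * \<theta> ^ length Ss + 0"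
    using theta_pos theta_less_1
    by (intro tendsto_add tendsto_const tendsto_mult_right_zero LIMSEQ_realpow_zero) auto
  moreover have "(\<lambda>k. \<bar>f k Ts - f k Ts'\<bar>) \<longlonglongrightarrow>
      \<bar>(ln (p (S # Ss @ Ts)) - ln (p (Ss @ Ts))) - (ln (p (S # Ss @ Ts')) - ln (p (Ss @ Ts')))\<bar>"
    using ne by (intro tendsto_intros lim)
  ultimately show ?thesis
    by (auto intro: LIMSEQ_le)
qed

end

section \<open>Invariant functions on words\<close>

abbreviation words :: "nat \<Rightarrow> 'a list set" where
  "words n \<equiv> {w. length w = n}"

lemma finite_words [simp]: "finite (words n :: 'a::finite list set)"
  using finite_lists_length_eq[of "UNIV :: 'a set" n] by simp

lemma sum_words_append:
  "(\<Sum>w\<in>words (m + n). f w) = (\<Sum>u\<in>words m. \<Sum>v\<in>words n. f (u @ v :: 'a::finite list))"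
proof -
  have "(\<Sum>w\<in>words (m + n). f w) = (\<Sum>(u, v)\<in>words m \<times> words n. f (u @ v))"
    by (rule sum.reindex_bij_witness[where i = "\<lambda>(u, v). u @ v" and j = "\<lambda>w. (take m w, drop m w)"])
      auto
  then show ?thesis
    by (simp add: sum.cartesian_product)
qed

lemma sum_words_Suc:
  "(\<Sum>w\<in>words (Suc n). f w) = (\<Sum>c\<in>UNIV. \<Sum>w\<in>words n. f (c # w :: 'a::finite list))"
proof -
  have "(\<Sum>w\<in>words (Suc n). f w) = (\<Sum>(c, w)\<in>UNIV \<times> words n. f (c # w))"
    by (rule sum.reindex_bij_witness[where i = "\<lambda>(c, w). c # w" and j = "\<lambda>w. (hd w, tl w)"])
      (auto simp: length_Suc_conv)
  then show ?thesis
    by (simp add: sum.cartesian_product)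
qed

lemma sum_words_snoc:
  "(\<Sum>w\<in>words (Suc n). f w) = (\<Sum>w\<in>words n. \<Sum>c\<in>UNIV. f (w @ [c] :: 'a::finite list))"
proof -
  have "(\<Sum>w\<in>words (Suc n). f w) = (\<Sum>(w, c)\<in>words n \<times> UNIV. f (w @ [c]))"
    by (rule sum.reindex_bij_witness[where i = "\<lambda>(w, c). w @ [c]" and j = "\<lambda>w. (butlast w, last w)"])
      (auto simp: length_Suc_conv_rev)
  then show ?thesis
    by (simp add: sum.cartesian_product)
qed

text \<open>\<open>q_snoc\<close> is additivity on cylinders and \<open>q_Cons\<close> is shift
  invariance. Stated for functions on words, this covers \<open>p\<close> without a measure having
  been built from it.\<close>

locale invariant_words =
  fixes q :: "'a::finite list \<Rightarrow> real"
  assumes q_nonneg: "0 \<le> q w"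
    and q_Nil: "q [] = 1"
    and q_snoc: "(\<Sum>c\<in>UNIV. q (w @ [c])) = q w"
    and q_Cons: "(\<Sum>c\<in>UNIV. q (c # w)) = q w"
begin

lemma q_future: "(\<Sum>v\<in>words n. q (u @ v)) = q u"
proof (induction n)
  case (Suc n)
  then show ?case
    using q_snoc[of "u @ _"] by (simp add: sum_words_snoc)
qed simp

lemma q_past: "(\<Sum>u\<in>words n. q (u @ v)) = q v"
proof (induction n arbitrary: v)
  case (Suc n)
  have "(\<Sum>u\<in>words (Suc n). q (u @ v)) = (\<Sum>w\<in>words n. \<Sum>c\<in>UNIV. q (w @ (c # v)))"
    by (simp add: sum_words_snoc)
  also have "\<dots> = (\<Sum>c\<in>UNIV. q (c # v))"
    using Suc by (subst sum.swap) simp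
  finally show ?case
    by (simp add: q_Cons)
qed simp

end

text \<open>Uniqueness by an \<open>L\<^sup>2\<close> argument: the energies \<open>E n\<close> of the densities \<open>f w = p w / q w\<close>
  increase and are bounded. Both \<open>f u\<close> and \<open>f v\<close> are then close to \<open>f (u @ v)\<close> for long words,
  and the quasi-Bernoulli bound decouples \<open>u\<close> from \<open>v\<close>, so that the variance of \<open>f\<close> vanishes.\<close>

lemma invariant_words_unique:
  fixes p q :: "'a::finite list \<Rightarrow> real"
  assumes "invariant_words p" "invariant_words q"
    and pos: "\<And>w. 0 < q w" and le: "\<And>w. p w \<le> C * q w"
    and \<kappa>: "0 < \<kappa>" "\<And>u v. \<kappa> * q u * q v \<le> q (u @ v)"
  shows "p = q"
proof -
  interpret p: invariant_words p by fact
  interpret q: invariant_words q by fact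
  define f where "f w = p w / q w" for w
  have p_eq: "p w = q w * f w" for w
    using pos[of w] by (simp add: f_def)
  have f_nonneg: "0 \<le> f w" for w
    using pos[of w] p.q_nonneg[of w] by (simp add: f_def)
  have f_le: "f w \<le> C" for w
    using pos[of w] le[of w] by (simp add: f_def pos_divide_le_eq)
  define E where "E n = (\<Sum>w\<in>words n. q w * (f w)\<^sup>2)" for n
  have q_total: "(\<Sum>w\<in>words n. q w) = 1" for n
    using q.q_future[of "[]" n] by (simp add: q.q_Nil)
  have p_total: "(\<Sum>w\<in>words n. q w * f w) = 1" for n
    using p.q_future[of "[]" n] p.q_Nil by (simp add: p_eq)
  \<comment> \<open>Orthogonality of martingale increments: the mean of \<open>f (u @ v)\<close>
    over \<open>v\<close>, weighted by \<open>q (u @ v)\<close>, is \<open>f u\<close>.\<close>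
  have future: "(\<Sum>u\<in>words m. \<Sum>v\<in>words n. q (u @ v) * (f (u @ v) - f u)\<^sup>2) = E (m + n) - E m" for m n
  proof -
    have "(\<Sum>v\<in>words n. q (u @ v) * (f (u @ v) - f u)\<^sup>2)
      = (\<Sum>v\<in>words n. q (u @ v) * (f (u @ v))\<^sup>2) - q u * (f u)\<^sup>2" for u
    proof -
      have "(\<Sum>v\<in>words n. q (u @ v) * (f (u @ v) - f u)\<^sup>2)
        = (\<Sum>v\<in>words n. q (u @ v) * (f (u @ v))\<^sup>2)
          - 2 * f u * (\<Sum>v\<in>words n. p (u @ v)) + (f u)\<^sup>2 * (\<Sum>v\<in>words n. q (u @ v))"
        by (simp add: p_eq power2_eq_square sum_distrib_left algebra_simps sum.distrib sum_subtractf)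
      then show ?thesis
        unfolding p.q_future q.q_future by (simp add: p_eq power2_eq_square)
    qed
    then show ?thesis
      by (simp add: E_def sum_words_append sum_subtractf)
  qed
  \<comment> \<open>The same in the reverse direction, by invariance: averaging over
    \<open>u\<close> gives \<open>f v\<close>.\<close>
  have past: "(\<Sum>u\<in>words m. \<Sum>v\<in>words n. q (u @ v) * (f (u @ v) - f v)\<^sup>2) = E (m + n) - E n" for m n
  proof -
    have "(\<Sum>u\<in>words m. q (u @ v) * (f (u @ v) - f v)\<^sup>2)
      = (\<Sum>u\<in>words m. q (u @ v) * (f (u @ v))\<^sup>2) - q v * (f v)\<^sup>2" for v
    proof -
      have "(\<Sum>u\<in>words m. q (u @ v) * (f (u @ v) - f v)\<^sup>2)
        = (\<Sum>u\<in>words m. q (u @ v) * (f (u @ v))\<^sup>2)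
          - 2 * f v * (\<Sum>u\<in>words m. p (u @ v)) + (f v)\<^sup>2 * (\<Sum>u\<in>words m. q (u @ v))"
        by (simp add: p_eq power2_eq_square sum_distrib_left algebra_simps sum.distrib sum_subtractf)
      then show ?thesis
        unfolding p.q_past q.q_past by (simp add: p_eq power2_eq_square)
    qed
    then show ?thesis
      by (subst sum.swap) (simp add: E_def sum_words_append sum_subtractf sum.swap[of _ "words m"])
  qed
  have nonneg: "0 \<le> (\<Sum>u\<in>words m. \<Sum>v\<in>words n. q (u @ v) * g u v)" if "\<And>u v. 0 \<le> g u v" for m n g
    using that pos by (intro sum_nonneg mult_nonneg_nonneg) (auto intro: less_imp_le)
  have "incseq E"
  proof (rule incseq_SucI)
    fix n show "E n \<le> E (Suc n)"
      using future[where m = n and n = 1] nonneg[where g = "\<lambda>u v. (f (u @ v) - f u)\<^sup>2" and m = n and n = 1] by simp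
  qed
  moreover have "E n \<le> C\<^sup>2" for n
  proof -
    have "E n \<le> (\<Sum>w\<in>words n. q w * C\<^sup>2)"
      unfolding E_def using pos f_nonneg f_le
      by (intro sum_mono mult_left_mono power_mono) (auto intro: less_imp_le)
    then show ?thesis
      by (simp add: q_total flip: sum_distrib_right)
  qed
  ultimately obtain L where L: "E \<longlonglongrightarrow> L" "\<And>n. E n \<le> L"
    using incseq_convergent[of E "C\<^sup>2"] by blast
  define V where "V n = E n - 1" for n
  have variance: "(\<Sum>u\<in>words n. \<Sum>v\<in>words n. q u * q v * (f u - f v)\<^sup>2) = 2 * V n" for n
  proof -
    have "(\<Sum>u\<in>words n. \<Sum>v\<in>words n. q u * q v * (f u - f v)\<^sup>2)
      = (\<Sum>u\<in>words n. q u * (f u)\<^sup>2 * (\<Sum>v\<in>words n. q v)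
         - 2 * (q u * f u) * (\<Sum>v\<in>words n. q v * f v) + q u * E n)"
      unfolding E_def by (intro sum.cong refl)
        (simp add: power2_eq_square sum_distrib_left algebra_simps sum.distrib sum_subtractf)
    also have "\<dots> = (\<Sum>u\<in>words n. q u * (f u)\<^sup>2) - 2 * (\<Sum>u\<in>words n. q u * f u)
        + (\<Sum>u\<in>words n. q u) * E n"
      by (simp add: q_total p_total sum.distrib sum_subtractf flip: sum_distrib_left sum_distrib_right)
    also have "\<dots> = 2 * V n"
      by (simp add: q_total p_total V_def E_def)
    finally show ?thesis .
  qed
  have V_le: "\<kappa> * (2 * V n) \<le> 4 * (L - E n)" for n
  proof -
    have "\<kappa> * (2 * V n) = (\<Sum>u\<in>words n. \<Sum>v\<in>words n. (\<kappa> * q u * q v) * (f u - f v)\<^sup>2)"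
      unfolding variance[symmetric] by (simp add: sum_distrib_left mult_ac)
    also have "\<dots> \<le> (\<Sum>u\<in>words n. \<Sum>v\<in>words n.
        q (u @ v) * (2 * (f (u @ v) - f u)\<^sup>2 + 2 * (f (u @ v) - f v)\<^sup>2))"
    proof (intro sum_mono mult_mono \<kappa>(2))
      fix u v
      have "0 \<le> (f (u @ v) - f u + (f (u @ v) - f v))\<^sup>2"
        by simp
      then show "(f u - f v)\<^sup>2 \<le> 2 * (f (u @ v) - f u)\<^sup>2 + 2 * (f (u @ v) - f v)\<^sup>2"
        by (simp add: power2_eq_square algebra_simps)
    qed (use pos in \<open>auto intro: less_imp_le\<close>)
    also have "\<dots> = 2 * (\<Sum>u\<in>words n. \<Sum>v\<in>words n. q (u @ v) * (f (u @ v) - f u)\<^sup>2)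
        + 2 * (\<Sum>u\<in>words n. \<Sum>v\<in>words n. q (u @ v) * (f (u @ v) - f v)\<^sup>2)"
      by (simp add: sum_distrib_left distrib_left sum.distrib mult_ac)
    also have "\<dots> = 4 * (E (n + n) - E n)"
      by (simp add: future past)
    also have "\<dots> \<le> 4 * (L - E n)"
      using L(2)[of "n + n"] by simp
    finally show ?thesis .
  qed
  have "(\<lambda>n. 4 * (L - E n)) \<longlonglongrightarrow> 4 * (L - L)"
    by (intro tendsto_intros L)
  moreover have "(\<lambda>n. \<kappa> * (2 * V n)) \<longlonglongrightarrow> \<kappa> * (2 * (L - 1))"
    unfolding V_def by (intro tendsto_intros L)
  \<comment> \<open>The energy gap tends to 0, so the limiting variance \<open>L - 1\<close> cannot
    be positive.\<close>
  ultimately have "\<kappa> * (2 * (L - 1)) \<le> 4 * (L - L)"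
    using V_le by (blast intro: LIMSEQ_le)
  then have "L \<le> 1"
    using \<kappa>(1) by (simp add: mult_le_0_iff)
  have "f w = 1" for w
  proof -
    define n where "n = length w"
    have "(\<Sum>w\<in>words n. q w * (f w - 1)\<^sup>2) = (\<Sum>w\<in>words n. q w * (f w)\<^sup>2)
        - 2 * (\<Sum>w\<in>words n. q w * f w) + (\<Sum>w\<in>words n. q w)"
      by (simp add: power2_eq_square algebra_simps sum.distrib sum_subtractf sum_distrib_left)
    also have "\<dots> \<le> 0"
      using L(2)[of n] \<open>L \<le> 1\<close> by (simp add: p_total q_total E_def)
    finally have "(\<Sum>w\<in>words n. q w * (f w - 1)\<^sup>2) = 0"
      using pos by (intro antisym sum_nonneg) (auto simp: less_imp_le)
    then have "q w * (f w - 1)\<^sup>2 = 0"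
      using pos by (subst (asm) sum_nonneg_eq_0_iff) (auto simp: n_def less_imp_le)
    then show ?thesis
      using pos[of w] by simp
  qed
  then show ?thesis
    by (simp add: fun_eq_iff p_eq)
qed

section \<open>The potential obtained from ratios of cylinder weights\<close>

lemma birkhoff_sum_Suc: "birkhoff_sum (Suc n) f a = f a + birkhoff_sum n f (shift a)"
  by (simp add: birkhoff_sum_def sum.lessThan_Suc_shift funpow_swap1 del: sum.lessThan_Suc)

text \<open>To be instantiated with the image of the given measure and with the images of the
  approximating measures, all with the same \<open>D\<close> and \<open>\<theta>\<close>.\<close>

locale ratio_words =
  fixes P :: "'b list \<Rightarrow> real" and D \<theta> :: real
  assumes P_pos: "0 < P w" and P_Nil: "P [] = 1"
    and theta: "0 < \<theta>" "\<theta> < 1"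
    and ratio: "\<bar>(ln (P (c # u @ v)) - ln (P (u @ v))) - (ln (P (c # u @ v')) - ln (P (u @ v')))\<bar>
      \<le> D * \<theta> ^ length u"
begin

definition R :: "nat \<Rightarrow> 'b sequence \<Rightarrow> real" where
  "R n b = ln (P (word b 0 n) / P (word b 1 n))"

definition \<phi> :: "'b sequence \<Rightarrow> real" where
  "\<phi> b = lim (\<lambda>n. R n b)"

lemma R_diff:
  assumes "word b 0 n = word b' 0 n" "n \<le> m" "n \<le> m'"
  shows "\<bar>R m b - R m' b'\<bar> \<le> D * \<theta> ^ n"
proof -
  \<comment> \<open>The letters with indices 1 to \<open>n\<close> form the common block of length
    \<open>n\<close>; index 0 is the letter in front of it.\<close>
  have split: "word b 1 k = word b 1 n @ word b (Suc n) k" "word b 0 k = b 0 # word b 1 k"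
    if "n \<le> k" for k and b :: "'b sequence"
  proof -
    have "[1..<Suc k] = [1..<Suc n] @ [Suc n..<Suc k]"
      using that by (metis Suc_le_mono le_add_diff_inverse upt_add_eq_append One_nat_def le_Suc_eq Suc_le_D zero_le)
    then show "word b 1 k = word b 1 n @ word b (Suc n) k"
      unfolding word_def by simp
    show "word b 0 k = b 0 # word b 1 k"
      unfolding word_def by (subst upt_conv_Cons) auto
  qed
  from assms(1) have "b 0 = b' 0" "word b 1 n = word b' 1 n"
    by (simp_all add: split(2)[OF order_refl])
  moreover have "length (word b 1 n) = n"
    by (simp add: word_def)
  moreover have "R m b = ln (P (b 0 # word b 1 n @ word b (Suc n) m)) - ln (P (word b 1 n @ word b (Suc n) m))"
    using split[OF assms(2), of b] unfolding R_def by (simp add: ln_divide_pos P_pos)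
  moreover have "R m' b' = ln (P (b' 0 # word b' 1 n @ word b' (Suc n) m')) - ln (P (word b' 1 n @ word b' (Suc n) m'))"
    using split[OF assms(3), of b'] unfolding R_def by (simp add: ln_divide_pos P_pos)
  ultimately show ?thesis
    using ratio[of "b 0" "word b 1 n" "word b (Suc n) m" "word b' (Suc n) m'"] by simp
qed

lemma R_tendsto: "(\<lambda>n. R n b) \<longlonglongrightarrow> \<phi> b"
proof -
  have "\<bar>R (Suc n) b - R n b\<bar> \<le> D * \<theta> ^ n" for n
    by (rule R_diff) auto
  from geometric_steps_converge[OF theta this] show ?thesis
    unfolding \<phi>_def using limI by fastforce
qed

lemma R_rate: "\<bar>R n b - \<phi> b\<bar> \<le> D * \<theta> ^ n"
proof (rule LIMSEQ_le_const2)
  show "(\<lambda>m. \<bar>R n b - R m b\<bar>) \<longlonglongrightarrow> \<bar>R n b - \<phi> b\<bar>"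
    by (intro tendsto_intros R_tendsto)
  show "\<exists>N. \<forall>m\<ge>N. \<bar>R n b - R m b\<bar> \<le> D * \<theta> ^ n"
    using R_diff[of b n b n] by blast
qed

lemma phi_variation:
  assumes "word b 0 n = word b' 0 n"
  shows "\<bar>\<phi> b - \<phi> b'\<bar> \<le> D * \<theta> ^ n"
proof (rule LIMSEQ_le_const2)
  show "(\<lambda>m. \<bar>R m b - R m b'\<bar>) \<longlonglongrightarrow> \<bar>\<phi> b - \<phi> b'\<bar>"
    by (intro tendsto_intros R_tendsto)
  show "\<exists>N. \<forall>m\<ge>N. \<bar>R m b - R m b'\<bar> \<le> D * \<theta> ^ n"
    using R_diff[OF assms] by blast
qed

lemma D_nonneg: "0 \<le> D"
  using phi_variation[of b 0 b] by simp

lemma word_shift: "word (shift b) m n = word b (Suc m) (Suc n)"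
  unfolding word_def shift_def by (subst map_Suc_upt[symmetric]) simp

text \<open>Removing letters from the left writes \<open>ln P\<close> as a sum of terms
  \<open>R\<close> along the orbit, with ever shorter words. Replacing them by \<open>\<phi>\<close>
  costs \<open>D * \<theta> ^ k\<close> at remaining index \<open>k\<close>, a geometric series.
  This is the Gibbs bound with pressure constant 0.\<close>

lemma ln_P_birkhoff: "\<bar>ln (P (word b 0 n)) - birkhoff_sum (Suc n) \<phi> b\<bar> \<le> D / (1 - \<theta>)"
proof -
  have "\<bar>ln (P (word b 0 n)) - birkhoff_sum (Suc n) \<phi> b\<bar> \<le> D / (1 - \<theta>) * (1 - \<theta> ^ Suc n)"
  proof (induction n arbitrary: b)
    case 0
    have "ln (P (word b 0 0)) = R 0 b"
      by (simp add: R_def word_def P_Nil)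
    then show ?case
      using R_rate[of 0 b] theta by (simp add: birkhoff_sum_def)
  next
    case (Suc n)
    have "ln (P (word b 0 (Suc n))) = R (Suc n) b + ln (P (word (shift b) 0 n))"
      by (simp add: R_def ln_divide_pos P_pos word_shift)
    moreover have "birkhoff_sum (Suc (Suc n)) \<phi> b = \<phi> b + birkhoff_sum (Suc n) \<phi> (shift b)"
      by (rule birkhoff_sum_Suc)
    moreover have "D / (1 - \<theta>) * (1 - \<theta> ^ Suc (Suc n))
        = D / (1 - \<theta>) * (1 - \<theta> ^ Suc n) + D * \<theta> ^ Suc n"
      using theta by (simp add: field_simps)
    ultimately show ?case
      using Suc[of "shift b"] R_rate[of "Suc n" b] by linarith
  qed
  also have "\<dots> \<le> D / (1 - \<theta>) * 1"
    using theta D_nonneg by (intro mult_left_mono) auto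
  finally show ?thesis
    by simp
qed

end

section \<open>Gibbs measures and their images\<close>

text \<open>The preimage of a cylinder under an amalgamation has this form, with fibres as the
  sets.\<close>

definition set_cylinder :: "'a set list \<Rightarrow> 'a sequence set" where
  "set_cylinder Ss = {a. \<forall>i<length Ss. a i \<in> Ss ! i}"

lemma set_cylinder_Nil [simp]: "set_cylinder [] = UNIV"
  by (simp add: set_cylinder_def)

lemma cylinder_eq_set_cylinder: "cylinder w = set_cylinder (map (\<lambda>c. {c}) w)"
  by (auto simp: cylinder_def set_cylinder_def)

lemma set_cylinder_Cons: "a \<in> set_cylinder (S # Ss) \<longleftrightarrow> a 0 \<in> S \<and> shift a \<in> set_cylinder Ss"
  by (auto simp: set_cylinder_def shift_def less_Suc_eq_0_disj)

lemma set_cylinder_snoc_UNIV: "set_cylinder (Ss @ [UNIV]) = set_cylinder Ss"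
  by (auto simp: set_cylinder_def nth_append less_Suc_eq)

lemma set_cylinder_split: "a \<in> set_cylinder (Ss @ S # Ts) \<longleftrightarrow> a (length Ss) \<in> S \<and> a \<in> set_cylinder (Ss @ UNIV # Ts)"
proof (induction Ss arbitrary: a)
  case (Cons S' Ss)
  then show ?case
    by (auto simp: set_cylinder_Cons shift_def)
qed (simp add: set_cylinder_Cons)

lemma openin_set_cylinder: "openin seq_topology (set_cylinder Ss)"
proof (induction Ss rule: rev_induct)
  case Nil
  then show ?case
    using openin_topspace[of seq_topology] by simp
next
  case (snoc S Ss)
  have "openin seq_topology {a. a (length Ss) \<in> S}"
    using openin_continuous_map_preimage[OF continuous_map_product_projection[of "length Ss" UNIV "\<lambda>_. discrete_topology UNIV"], of S]
    by (simp add: seq_topology_def)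
  moreover have "set_cylinder (Ss @ [S]) = {a. a (length Ss) \<in> S} \<inter> set_cylinder Ss"
    using set_cylinder_split[of _ Ss S "[]"] by (auto simp: set_cylinder_snoc_UNIV)
  ultimately show ?case
    using snoc by auto
qed

lemma sets_set_cylinder: "set_cylinder Ss \<in> sets seq_borel"
  using openin_set_cylinder by (auto simp: sets_seq_borel)

lemma word_eq_iff: "word a 0 n = word b 0 n \<longleftrightarrow> agree (Suc n) a b"
  by (auto simp: word_def agree_def simp del: upt_Suc)

lemma agree_cylinder: "a \<in> cylinder (word b 0 n) \<longleftrightarrow> agree (Suc n) a b"
  by (auto simp: cylinder_def word_def agree_def simp del: upt_Suc)

lemma word_cylinder: "a \<in> cylinder (word b 0 n) \<longleftrightarrow> word a 0 n = word b 0 n"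
  by (simp add: agree_cylinder word_eq_iff)

lemma openin_cylinder_subset:
  assumes "openin seq_topology U" "a \<in> U"
  obtains n where "cylinder (word a 0 n) \<subseteq> U"
proof -
  obtain X where X: "finite {i. X i \<noteq> (UNIV :: 'a set)}" "\<And>i. a i \<in> X i" "Pi\<^sub>E UNIV X \<subseteq> U"
    using assms unfolding seq_topology_def openin_product_topology_alt by (auto simp: PiE_iff)
  obtain n where n: "{i. X i \<noteq> UNIV} \<subseteq> {..n}"
    using X(1) finite_nat_iff_bounded_le by blast
  have "cylinder (word a 0 n) \<subseteq> Pi\<^sub>E UNIV X"
  proof
    fix b assume "b \<in> cylinder (word a 0 n)"
    then have "b i = a i" if "i \<le> n" for i
      using that by (simp add: word_cylinder word_eq_iff agree_def)
    then have "b i \<in> X i" for i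
      using n X(2)[of i] by (cases "i \<le> n") auto
    then show "b \<in> Pi\<^sub>E UNIV X"
      by auto
  qed
  from subset_trans[OF this X(3)] show ?thesis
    by (rule that)
qed

lemma measure_set_cylinder_split:
  fixes \<mu> :: "'a::finite sequence measure"
  assumes "prob_space \<mu>" "sets \<mu> = sets seq_borel"
  shows "measure \<mu> (set_cylinder (Ss @ S # Ts)) = (\<Sum>c\<in>S. measure \<mu> (set_cylinder (Ss @ {c} # Ts)))"
proof -
  interpret prob_space \<mu> by fact
  have split: "set_cylinder (Ss @ S' # Ts) = {a \<in> set_cylinder (Ss @ UNIV # Ts). a (length Ss) \<in> S'}" for S'
    using set_cylinder_split[of _ Ss S' Ts] by blast
  have "set_cylinder (Ss @ S # Ts) = (\<Union>c\<in>S. set_cylinder (Ss @ {c} # Ts))"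
    unfolding split[of S] split[of "{_}"] by blast
  moreover have "disjoint_family_on (\<lambda>c. set_cylinder (Ss @ {c} # Ts)) S"
    unfolding disjoint_family_on_def split[of "{_}"] by blast
  ultimately show ?thesis
    using sets_set_cylinder assms(2) by (auto intro!: finite_measure_finite_Union)
qed

lemma measure_shift_vimage:
  assumes "sets \<mu> = sets seq_borel" "shift_invariant \<mu>" "E \<in> sets seq_borel"
  shows "measure \<mu> (shift -` E) = measure \<mu> E"
proof -
  have "space \<mu> = UNIV"
    using sets_eq_imp_space_eq[OF assms(1)] by simp
  moreover have "shift \<in> measurable \<mu> seq_borel"
    using measurable_shift measurable_cong_sets[OF assms(1) refl] by blast
  ultimately have "measure (distr \<mu> seq_borel shift) E = measure \<mu> (shift -` E)"
    using assms(3) by (simp add: measure_distr)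
  with assms(2) show ?thesis
    by (simp add: shift_invariant_def)
qed

lemma invariant_words_measure:
  fixes \<mu> :: "'a::finite sequence measure"
  assumes \<mu>: "prob_space \<mu>" "sets \<mu> = sets seq_borel" "shift_invariant \<mu>"
  shows "invariant_words (\<lambda>w. measure \<mu> (cylinder w))"
proof
  interpret prob_space \<mu> by fact
  have space: "space \<mu> = UNIV"
    using sets_eq_imp_space_eq[OF \<mu>(2)] by simp
  show "measure \<mu> (cylinder []) = 1"
    using prob_space by (simp add: cylinder_eq_set_cylinder space)
  fix w :: "'a list"
  show "(\<Sum>c\<in>UNIV. measure \<mu> (cylinder (w @ [c]))) = measure \<mu> (cylinder w)"
    using measure_set_cylinder_split[OF \<mu>(1,2), of "map (\<lambda>c. {c}) w" UNIV "[]"]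
    by (simp add: cylinder_eq_set_cylinder set_cylinder_snoc_UNIV)
  have "shift -` cylinder w = set_cylinder (UNIV # map (\<lambda>c. {c}) w)"
    by (auto simp: set_cylinder_Cons cylinder_eq_set_cylinder)
  then have "measure \<mu> (set_cylinder (UNIV # map (\<lambda>c. {c}) w)) = measure \<mu> (cylinder w)"
    using measure_shift_vimage[OF \<mu>(2,3), of "cylinder w"] by (simp add: cylinder_eq_set_cylinder sets_set_cylinder)
  then show "(\<Sum>c\<in>UNIV. measure \<mu> (cylinder (c # w))) = measure \<mu> (cylinder w)"
    using measure_set_cylinder_split[OF \<mu>(1,2), of "[]" UNIV "map (\<lambda>c. {c}) w"]
    by (simp add: cylinder_eq_set_cylinder)
qed simp

section \<open>Identification of Gibbs measures with the limit \<open>p\<close>\<close>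

abbreviation singles :: "'a list \<Rightarrow> 'a set list" where
  "singles w \<equiv> map (\<lambda>c. {c}) w"

definition prepend :: "'a list \<Rightarrow> 'a sequence \<Rightarrow> 'a sequence" where
  "prepend w x = foldr scons w x"

lemma prepend_cylinder: "prepend w x \<in> cylinder w"
  by (induction w) (auto simp: prepend_def cylinder_eq_set_cylinder set_cylinder_Cons)

lemma word_prepend:
  assumes "length w = Suc n"
  shows "word (prepend w x) 0 n = w"
proof (rule nth_equalityI)
  show "length (word (prepend w x) 0 n) = length w"
    by (simp add: word_def assms)
  fix i assume "i < length (word (prepend w x) 0 n)"
  then have "i < Suc n"
    by (simp add: word_def)
  then show "word (prepend w x) 0 n ! i = w ! i"
    using prepend_cylinder[of w x] assms by (simp add: word_def cylinder_def del: upt_Suc)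
qed

context hoelder_transfer
begin

lemma fold_transfer_singles:
  "fold transfer (singles w) F x = exp (birkhoff_sum (length w) \<psi> (prepend w x)) * F (prepend w x)"
proof (induction w arbitrary: F)
  case Nil
  then show ?case
    by (simp add: prepend_def birkhoff_sum_def)
next
  case (Cons c w)
  have "prepend (c # w) x = scons c (prepend w x)"
    by (simp add: prepend_def)
  then show ?case
    using Cons by (simp add: birkhoff_sum_Suc transfer_def exp_add)
qed

lemma Z_singles: "Z (singles w) = exp (birkhoff_sum (length w) \<psi> (prepend w undefined))"
  by (simp add: Z_def fold_transfer_singles)

lemma sum_Z_singles: "(\<Sum>w\<in>words n. Z (singles w)) = Z (full n)"
proof -
  have "(\<Sum>w\<in>words n. Z (singles v @ singles w)) = Z (singles v @ full n)" for v
  proof (induction n arbitrary: v)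
    case (Suc n)
    have "(\<Sum>w\<in>words (Suc n). Z (singles v @ singles w))
      = (\<Sum>c\<in>UNIV. \<Sum>w\<in>words n. Z (singles (v @ [c]) @ singles w))"
      by (simp add: sum_words_Suc)
    also have "\<dots> = (\<Sum>c\<in>UNIV. Z (singles v @ {c} # full n))"
      unfolding Suc by simp
    finally show ?case
      by (simp flip: Z_split)
  qed simp
  from this[of "[]"] show ?thesis
    by simp
qed

lemma singles_nonempty: "{} \<notin> set (singles w)"
  by auto

lemma invariant_words_p: "invariant_words (\<lambda>w. p (singles w))"
proof
  fix w :: "'a list"
  show "0 \<le> p (singles w)"
    using p_pos[OF singles_nonempty] by (simp add: less_imp_le)
  show "(\<Sum>c\<in>UNIV. p (singles (w @ [c]))) = p (singles w)"
    using p_split[OF singles_nonempty[of w], of "[]" UNIV] p_snoc_UNIV[OF singles_nonempty, of w]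
    by simp
  show "(\<Sum>c\<in>UNIV. p (singles (c # w))) = p (singles w)"
    using p_split[OF _ singles_nonempty[of w], of "[]" UNIV] p_Cons_UNIV[OF singles_nonempty, of w]
    by simp
qed simp

text \<open>The pressure constant of the given measure is unknown. Summing its lower Gibbs bound
  over all words of one length compares \<open>exp (- (real (Suc n) * P))\<close> with
  \<open>1 / Z (full (Suc n))\<close>, which eliminates it.\<close>

lemma gibbs_measure_le_p:
  assumes gibbs: "gibbs_measure \<psi> \<mu>"
  shows "\<exists>C. \<forall>w. measure \<mu> (cylinder w) \<le> C * p (singles w)"
proof -
  have \<mu>: "prob_space \<mu>" "sets \<mu> = sets seq_borel" "shift_invariant \<mu>"
    using gibbs by (auto simp: gibbs_measure_def)
  interpret \<mu>: invariant_words "\<lambda>w. measure \<mu> (cylinder w)"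
    by (rule invariant_words_measure[OF \<mu>])
  obtain C P where C: "C \<ge> 1"
    and "\<forall>n a. let q = measure \<mu> (cylinder (word a 0 n)) /
        exp (birkhoff_sum (n + 1) \<psi> a - real (n + 1) * P) in 1 / C \<le> q \<and> q \<le> C"
    using gibbs unfolding gibbs_measure_def by blast
  then have CP: "1 / C \<le> measure \<mu> (cylinder (word a 0 n)) / exp (birkhoff_sum (n + 1) \<psi> a - real (n + 1) * P)"
    "measure \<mu> (cylinder (word a 0 n)) / exp (birkhoff_sum (n + 1) \<psi> a - real (n + 1) * P) \<le> C" for n a
    unfolding Let_def by blast+
  have "measure \<mu> (cylinder w) \<le> C\<^sup>2 * exp (4 * H) * p (singles w)" for w
  proof (cases w)
    case Nil
    \<comment> \<open>The Gibbs bounds concern nonempty words only, so the empty word is treated by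
      itself.\<close>
    have "1 \<le> C\<^sup>2 * exp (4 * H)"
      using C H_pos mult_mono[of 1 "C\<^sup>2" 1 "exp (4 * H)"] by (simp add: one_le_power)
    then show ?thesis
      using Nil \<mu>.q_Nil by simp
  next
    case (Cons c w')
    define n where "n = length w'"
    have len: "length w = Suc n"
      by (simp add: Cons n_def)
    let ?e = "exp (- (real (Suc n) * P))"
    have bounds: "Z (singles v) * ?e \<le> C * measure \<mu> (cylinder v)"
      "measure \<mu> (cylinder v) \<le> C * (Z (singles v) * ?e)" if "length v = Suc n" for v
    proof -
      have "exp (birkhoff_sum (n + 1) \<psi> (prepend v undefined) - real (n + 1) * P) = Z (singles v) * ?e"
        by (simp add: Z_singles that flip: exp_add)
      then show "Z (singles v) * ?e \<le> C * measure \<mu> (cylinder v)"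
        "measure \<mu> (cylinder v) \<le> C * (Z (singles v) * ?e)"
        using CP[of "prepend v undefined" n] C Z_pos[OF singles_nonempty, of v]
        by (simp_all add: word_prepend[OF that] field_simps)
    qed
    have "Z (full (Suc n)) * ?e = (\<Sum>v\<in>words (Suc n). Z (singles v) * ?e)"
      by (simp only: sum_Z_singles flip: sum_distrib_right)
    also have "\<dots> \<le> (\<Sum>v\<in>words (Suc n). C * measure \<mu> (cylinder v))"
      by (intro sum_mono bounds) auto
    also have "\<dots> = C"
      using \<mu>.q_future[of "[]" "Suc n"] \<mu>.q_Nil by (simp flip: sum_distrib_left)
    finally have e: "?e \<le> C / Z (full (Suc n))"
      using Z_pos[OF full_nonempty, of "Suc n"] by (simp add: pos_le_divide_eq mult.commute)
    have "measure \<mu> (cylinder w) \<le> C * (Z (singles w) * ?e)"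
      by (rule bounds[OF len])
    also have "\<dots> \<le> C * (Z (singles w) * (C / Z (full (Suc n))))"
      using C Z_pos[OF singles_nonempty, of w] by (intro mult_left_mono e) auto
    also have "\<dots> = C\<^sup>2 * (Z (singles w) / Z (full (Suc n)))"
      by (simp add: power2_eq_square)
    also have "\<dots> \<le> C\<^sup>2 * (exp (4 * H) * p (singles w))"
    proof (rule mult_left_mono)
      have "exp (- 4 * H) * (Z (singles w) / Z (full (Suc n))) \<le> p (singles w)"
        using p_ge[OF singles_nonempty, of w] by (simp add: len)
      then have "exp (4 * H) * (exp (- 4 * H) * (Z (singles w) / Z (full (Suc n))))
          \<le> exp (4 * H) * p (singles w)"
        by (rule mult_left_mono) simp
      then show "Z (singles w) / Z (full (Suc n)) \<le> exp (4 * H) * p (singles w)"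
        by (simp only: mult.assoc[symmetric] flip: exp_add) simp
    qed simp
    finally show ?thesis
      by (simp add: mult.assoc)
  qed
  then show ?thesis
    by blast
qed

text \<open>Uniqueness gives equality on words. Both sides are additive in each set, so an induction
  with a prefix of single letters extends it to lists of sets.\<close>

lemma gibbs_measure_set_cylinder:
  assumes gibbs: "gibbs_measure \<psi> \<mu>" and Ss: "{} \<notin> set Ss"
  shows "measure \<mu> (set_cylinder Ss) = p Ss"
proof -
  have \<mu>: "prob_space \<mu>" "sets \<mu> = sets seq_borel" "shift_invariant \<mu>"
    using gibbs by (auto simp: gibbs_measure_def)
  obtain C where C: "\<And>w. measure \<mu> (cylinder w) \<le> C * p (singles w)"
    using gibbs_measure_le_p[OF gibbs] by blast
  have "(\<lambda>w. measure \<mu> (cylinder w)) = (\<lambda>w. p (singles w))"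
  proof (rule invariant_words_unique[OF invariant_words_measure[OF \<mu>] invariant_words_p _ C])
    show "0 < p (singles w)" for w
      by (rule p_pos[OF singles_nonempty])
    show "exp (- 14 * H) * p (singles u) * p (singles v) \<le> p (singles (u @ v))" for u v
      using p_append_ge[OF singles_nonempty singles_nonempty, of u v] by simp
  qed simp
  then have word: "measure \<mu> (cylinder w) = p (singles w)" for w
    by metis
  have "measure \<mu> (set_cylinder (singles v @ Ss)) = p (singles v @ Ss)" for v
    using Ss
  proof (induction Ss arbitrary: v)
    case Nil
    then show ?case
      using word[of v] by (simp add: cylinder_eq_set_cylinder)
  next
    case (Cons S Ss)
    have "measure \<mu> (set_cylinder (singles v @ {c} # Ss)) = p (singles v @ {c} # Ss)" for c
      using Cons.IH[of "v @ [c]"] Cons.prems by simp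
    moreover have "S \<noteq> {}" "{} \<notin> set Ss"
      using Cons.prems by auto
    ultimately show ?case
      using p_split[OF singles_nonempty[of v] \<open>{} \<notin> set Ss\<close> \<open>S \<noteq> {}\<close>]
      by (simp add: measure_set_cylinder_split[OF \<mu>(1,2), of "singles v" S Ss])
  qed
  from this[of "[]"] show ?thesis
    by simp
qed

end

section \<open>Exchange of limits along the approximants\<close>

lemma tendsto_uniform_rate:
  fixes f :: "nat \<Rightarrow> nat \<Rightarrow> real"
  assumes \<epsilon>: "\<epsilon> \<longlonglongrightarrow> 0" and f: "\<And>r k. \<bar>f r k - F r\<bar> \<le> \<epsilon> k" and g: "\<And>k. \<bar>g k - G\<bar> \<le> \<epsilon> k"
    and lim: "\<And>k. (\<lambda>r. f r k) \<longlonglongrightarrow> g k"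
  shows "F \<longlonglongrightarrow> G"
proof (rule tendstoI)
  fix e :: real assume "0 < e"
  then obtain k where k: "\<epsilon> k < e / 3"
    using order_tendstoD(2)[OF \<epsilon>, of "e / 3"] by (auto simp: eventually_sequentially)
  have "\<forall>\<^sub>F r in sequentially. dist (f r k) (g k) < e / 3"
    using \<open>0 < e\<close> by (intro tendstoD[OF lim]) auto
  then show "\<forall>\<^sub>F r in sequentially. dist (F r) G < e"
  proof eventually_elim
    case (elim r)
    then show ?case
      using f[of r k] g[of k] k unfolding dist_real_def by linarith
  qed
qed

text \<open>For a fixed window, \<open>Q\<close> is a quotient of finite sums and depends
  continuously on the values of the potential; the rate in the window size is the same for all
  \<open>r\<close>.\<close>

lemma (in hoelder_transfer) p_tendsto:
  assumes approx: "\<And>r. hoelder_transfer K \<rho> (\<psi>r r)" and lim: "\<And>x. (\<lambda>r. \<psi>r r x) \<longlonglongrightarrow> \<psi> x"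
    and Ss: "{} \<notin> set Ss"
  shows "(\<lambda>r. hoelder_transfer.p (\<psi>r r) Ss) \<longlonglongrightarrow> p Ss"
proof -
  interpret r: hoelder_transfer K \<rho> "\<psi>r r" for r
    by (rule approx)
  have fold: "(\<lambda>r. fold (r.transfer r) Ss (Fr r) x) \<longlonglongrightarrow> fold transfer Ss F x"
    if "\<And>y. (\<lambda>r. Fr r y) \<longlonglongrightarrow> F y" for Fr F x and Ss :: "'a set list"
    using that
  proof (induction Ss arbitrary: Fr F)
    case (Cons S Ss)
    have "(\<lambda>r. r.transfer r S (Fr r) y) \<longlonglongrightarrow> transfer S F y" for y
      unfolding r.transfer_def transfer_def by (intro tendsto_intros lim Cons.prems)
    from Cons.IH[of "\<lambda>r. r.transfer r S (Fr r)" "transfer S F", OF this] show ?case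
      by simp
  qed simp
  have Z: "(\<lambda>r. r.Z r Ts) \<longlonglongrightarrow> Z Ts" for Ts
    unfolding r.Z_def Z_def by (intro fold tendsto_const)
  have Q: "(\<lambda>r. r.Q r k k Ss) \<longlonglongrightarrow> Q k k Ss" for k
    unfolding r.Q_def Q_def using Z_pos[OF full_nonempty, of "k + length Ss + k"]
    by (intro tendsto_divide Z) simp
  have "(\<lambda>r. ln (r.p r Ss)) \<longlonglongrightarrow> ln (p Ss)"
  proof (rule tendsto_uniform_rate)
    show "(\<lambda>k. 2 * D / (1 - \<theta>) * \<theta> ^ k) \<longlonglongrightarrow> 0"
      using theta_pos theta_less_1 by (intro tendsto_mult_right_zero LIMSEQ_realpow_zero) auto
    show "\<bar>ln (r.Q r k k Ss) - ln (r.p r Ss)\<bar> \<le> 2 * D / (1 - \<theta>) * \<theta> ^ k" for r k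
      by (rule r.Q_rate[OF Ss])
    show "\<bar>ln (Q k k Ss) - ln (p Ss)\<bar> \<le> 2 * D / (1 - \<theta>) * \<theta> ^ k" for k
      by (rule Q_rate[OF Ss])
    show "(\<lambda>r. ln (r.Q r k k Ss)) \<longlonglongrightarrow> ln (Q k k Ss)" for k
      using Q_pos[OF Ss, of k k] by (intro tendsto_ln Q) simp
  qed
  from tendsto_exp[OF this] show ?thesis
    using r.p_pos[OF Ss] p_pos[OF Ss] by simp
qed

section \<open>Images of measures under the amalgamation, support and continuity\<close>

lemma
  fixes \<mu> :: "'a sequence measure" and \<pi> :: "'a \<Rightarrow> 'b"
  assumes \<mu>: "prob_space \<mu>" "sets \<mu> = sets seq_borel"
  shows prob_space_pushforward: "prob_space (pushforward \<pi> \<mu>)"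
    and sets_pushforward: "sets (pushforward \<pi> \<mu>) = sets seq_borel"
    and shift_invariant_pushforward: "shift_invariant \<mu> \<Longrightarrow> shift_invariant (pushforward \<pi> \<mu>)"
    and measure_pushforward_cylinder:
      "measure (pushforward \<pi> \<mu>) (cylinder v) = measure \<mu> (set_cylinder (map (\<lambda>b. \<pi> -` {b}) v))"
proof -
  have meas: "amalgamation \<pi> \<in> measurable \<mu> seq_borel"
    using measurable_amalgamation measurable_cong_sets[OF \<mu>(2) refl] by blast
  have meas_shift: "shift \<in> measurable \<mu> seq_borel"
    using measurable_shift measurable_cong_sets[OF \<mu>(2) refl] by blast
  show "prob_space (pushforward \<pi> \<mu>)"
    unfolding pushforward_def by (rule prob_space.prob_space_distr[OF \<mu>(1) meas])
  show "sets (pushforward \<pi> \<mu>) = sets seq_borel"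
    by (simp add: pushforward_def)
  have space: "space \<mu> = UNIV"
    using sets_eq_imp_space_eq[OF \<mu>(2)] by simp
  have "amalgamation \<pi> -` cylinder v = set_cylinder (map (\<lambda>b. \<pi> -` {b}) v)"
    by (auto simp: amalgamation_def cylinder_def set_cylinder_def)
  then show "measure (pushforward \<pi> \<mu>) (cylinder v) = measure \<mu> (set_cylinder (map (\<lambda>b. \<pi> -` {b}) v))"
    unfolding pushforward_def using sets_set_cylinder[of "singles v"]
    by (subst measure_distr[OF meas]) (simp_all add: cylinder_eq_set_cylinder space)
  show "shift_invariant (pushforward \<pi> \<mu>)" if "shift_invariant \<mu>"
  proof -
    have "distr (distr \<mu> seq_borel (amalgamation \<pi>)) seq_borel shift
        = distr \<mu> seq_borel (shift \<circ> amalgamation \<pi>)"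
      by (rule distr_distr[OF measurable_shift meas])
    also have "shift \<circ> amalgamation \<pi> = amalgamation \<pi> \<circ> shift"
      by (auto simp: shift_def amalgamation_def)
    also have "distr \<mu> seq_borel \<dots> = distr (distr \<mu> seq_borel shift) seq_borel (amalgamation \<pi>)"
      by (rule distr_distr[OF measurable_amalgamation meas_shift, symmetric])
    also have "distr \<mu> seq_borel shift = \<mu>"
      using that by (simp add: shift_invariant_def)
    finally show ?thesis
      by (simp add: shift_invariant_def pushforward_def)
  qed
qed

lemma variation_le_iff:
  "variation n f \<le> ereal B \<longleftrightarrow> (\<forall>a b. word a 0 n = word b 0 n \<longrightarrow> \<bar>f a - f b\<bar> \<le> B)"
proof -
  have "variation n f \<le> ereal B \<longleftrightarrow> (\<forall>a b. word a 0 n = word b 0 n \<longrightarrow> ereal \<bar>f a - f b\<bar> \<le> ereal B)"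
    unfolding variation_def Sup_le_iff by blast
  then show ?thesis
    by simp
qed

lemma support_eq_UNIV:
  assumes "prob_space \<mu>" "sets \<mu> = sets seq_borel" "\<And>w. 0 < measure \<mu> (cylinder w)"
  shows "support \<mu> = UNIV"
proof -
  interpret prob_space \<mu> by fact
  have "0 < measure \<mu> U" if U: "openin seq_topology U" "a \<in> U" for U a
  proof -
    obtain n where n: "cylinder (word a 0 n) \<subseteq> U"
      using openin_cylinder_subset[OF U] .
    have "U \<in> sets \<mu>"
      using U(1) assms(2) by (auto simp: sets_seq_borel)
    from finite_measure_mono[OF n this] assms(3)[of "word a 0 n"] show ?thesis
      by linarith
  qed
  then show ?thesis
    by (auto simp: support_def)
qed

context ratio_words
begin

lemma phi_continuous: "continuous_map seq_topology euclideanreal \<phi>"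
  unfolding continuous_map_def
proof (intro conjI allI impI)
  fix U :: "real set" assume "openin euclideanreal U"
  then have U: "open U"
    by simp
  show "openin seq_topology {b \<in> topspace seq_topology. \<phi> b \<in> U}"
  proof (subst openin_subopen, intro ballI)
    fix b assume "b \<in> {b \<in> topspace seq_topology. \<phi> b \<in> U}"
    then obtain e where e: "0 < e" "\<And>y. \<bar>y - \<phi> b\<bar> < e \<Longrightarrow> y \<in> U"
      using U by (auto simp: open_dist dist_real_def)
    have "(\<lambda>n. D * \<theta> ^ n) \<longlonglongrightarrow> 0"
      using theta by (intro tendsto_mult_right_zero LIMSEQ_realpow_zero) auto
    then obtain n where n: "D * \<theta> ^ n < e"
      using order_tendstoD(2)[of _ 0 sequentially e] e(1) by (auto simp: eventually_sequentially)
    have "cylinder (word b 0 n) \<subseteq> {b \<in> topspace seq_topology. \<phi> b \<in> U}"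
      using phi_variation n by (fastforce simp: word_cylinder intro!: e(2))
    moreover have "b \<in> cylinder (word b 0 n)"
      by (simp add: word_cylinder)
    ultimately show "\<exists>T. openin seq_topology T \<and> b \<in> T \<and> T \<subseteq> {b \<in> topspace seq_topology. \<phi> b \<in> U}"
      using openin_set_cylinder by (auto simp: cylinder_eq_set_cylinder)
  qed
qed simp

lemma P_bounds:
  "exp (- (D / (1 - \<theta>))) \<le> P (word b 0 n) / exp (birkhoff_sum (Suc n) \<phi> b)"
  "P (word b 0 n) / exp (birkhoff_sum (Suc n) \<phi> b) \<le> exp (D / (1 - \<theta>))"
proof -
  have eq: "P (word b 0 n) / exp (birkhoff_sum (Suc n) \<phi> b)
      = exp (ln (P (word b 0 n)) - birkhoff_sum (Suc n) \<phi> b)"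
    by (simp add: exp_diff P_pos)
  show "exp (- (D / (1 - \<theta>))) \<le> P (word b 0 n) / exp (birkhoff_sum (Suc n) \<phi> b)"
    "P (word b 0 n) / exp (birkhoff_sum (Suc n) \<phi> b) \<le> exp (D / (1 - \<theta>))"
    unfolding eq exp_le_cancel_iff using ln_P_birkhoff[of b n] by linarith+
qed

end

section \<open>Pressure of the potential obtained from ratios\<close>

lemma funpow_shift: "(shift ^^ n) a = (\<lambda>i. a (i + n))"
  by (induction n arbitrary: a) (simp_all add: shift_def)

lemma sum_periodic_points:
  "(\<Sum>a | (shift ^^ Suc n) a = (a :: 'a sequence). f (word a 0 n)) = (\<Sum>w\<in>words (Suc n). f w)"
proof (rule sum.reindex_bij_witness[where j = "\<lambda>a. word a 0 n" and i = "\<lambda>w i. w ! (i mod Suc n)"])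
  fix a :: "'a sequence" assume "a \<in> {a. (shift ^^ Suc n) a = a}"
  then have per: "a (i + Suc n) = a i" for i
    unfolding funpow_shift by (metis (mono_tags, lifting) mem_Collect_eq)
  have "a (i + k * Suc n) = a i" for i k
  proof (induction k)
    case (Suc k)
    then show ?case
      using per[of "i + k * Suc n"] by (simp add: ac_simps)
  qed simp
  from this[of "_ mod Suc n" "_ div Suc n"] have "a (i mod Suc n) = a i" for i
    by (metis add.commute div_mult_mod_eq)
  then show "(\<lambda>i. word a 0 n ! (i mod Suc n)) = a"
    by (simp add: word_def del: upt_Suc)
  show "word a 0 n \<in> words (Suc n)"
    by (simp add: word_def)
next
  fix w :: "'a list" assume w: "w \<in> words (Suc n)"
  then show "word (\<lambda>i. w ! (i mod Suc n)) 0 n = w"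
    by (intro nth_equalityI) (simp_all add: word_def del: upt_Suc)
  show "(\<lambda>i. w ! (i mod Suc n)) \<in> {a. (shift ^^ Suc n) a = a}"
    by (simp only: funpow_shift mod_add_self2 mem_Collect_eq)
qed simp

text \<open>Periodic points correspond to words, whose weights add up to 1. The Gibbs bound thus
  keeps the sum over periodic points between two positive constants, and dividing its logarithm by
  \<open>n\<close> leaves 0.\<close>

lemma ratio_words_normalized:
  fixes P :: "'b::finite list \<Rightarrow> real"
  assumes "ratio_words P D \<theta>" and sum_P: "\<And>n. (\<Sum>w\<in>words n. P w) = 1"
  shows "normalized (ratio_words.\<phi> P)"
proof -
  interpret ratio_words P D \<theta> by fact
  define s where "s n = (\<Sum>b | (shift ^^ n) b = b. exp (birkhoff_sum n \<phi> b))" for n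
  define c where "c = D / (1 - \<theta>)"
  have s: "\<bar>ln (s (Suc n))\<bar> \<le> c" for n
  proof -
    let ?A = "{b. (shift ^^ Suc n) b = b}"
    have P_sum: "(\<Sum>b\<in>?A. P (word b 0 n)) = 1"
      unfolding sum_periodic_points by (rule sum_P)
    have "exp (- c) * P (word b 0 n) \<le> exp (birkhoff_sum (Suc n) \<phi> b)"
      "exp (birkhoff_sum (Suc n) \<phi> b) \<le> exp c * P (word b 0 n)" for b
      using P_bounds[of b n] by (simp_all add: c_def exp_minus field_simps)
    then have "(\<Sum>b\<in>?A. exp (- c) * P (word b 0 n)) \<le> s (Suc n)"
      "s (Suc n) \<le> (\<Sum>b\<in>?A. exp c * P (word b 0 n))"
      unfolding s_def by (auto intro!: sum_mono)
    then have "exp (- c) \<le> s (Suc n)" "s (Suc n) \<le> exp c"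
      unfolding sum_distrib_left[symmetric] P_sum by simp_all
    moreover from this(1) have "0 < s (Suc n)"
      by (rule less_le_trans[rotated]) simp
    ultimately have "- c \<le> ln (s (Suc n))" "ln (s (Suc n)) \<le> ln (exp c)"
      by (simp_all add: ln_ge_iff del: ln_exp)
    then show ?thesis
      by simp
  qed
  have "(\<lambda>n. 1 / real n * ln (s n)) \<longlonglongrightarrow> 0"
  proof (rule Lim_null_comparison)
    show "\<forall>\<^sub>F n in sequentially. norm (1 / real n * ln (s n)) \<le> c / real n"
      using eventually_gt_at_top[of 0]
    proof eventually_elim
      case (elim n)
      then show ?case
        using s[of "n - 1"] by (simp add: abs_mult divide_right_mono)
    qed
    show "(\<lambda>n. c / real n) \<longlonglongrightarrow> 0"
      by (rule lim_const_over_n)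
  qed
  then have "(\<lambda>n. ereal (1 / real n * ln (s n))) \<longlonglongrightarrow> ereal 0"
    by (intro tendsto_ereal)
  from lim_imp_Limsup[OF _ this] show ?thesis
    by (simp add: normalized_def pressure_def s_def zero_ereal_def)
qed

lemma agree_mono: "agree n x y \<Longrightarrow> m \<le> n \<Longrightarrow> agree m x y"
  by (simp add: agree_def)

lemma agree_trans: "agree n x y \<Longrightarrow> agree n y z \<Longrightarrow> agree n x z"
  by (simp add: agree_def)

context hoelder_transfer
begin

text \<open>The approximants inherit \<open>K\<close> and \<open>\<rho>\<close>. For
  \<open>r \<le> n\<close> the two maxima run over the same cylinder; otherwise maximizers for
  \<open>x\<close> and \<open>y\<close> still share the first \<open>Suc n\<close> letters.\<close>

lemma hoelder_transfer_approximant: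
  assumes cont: "continuous_map seq_topology euclideanreal \<psi>"
  shows "hoelder_transfer K \<rho> (approximant r \<psi>)"
proof
  fix n and x y :: "'a sequence" assume xy: "agree (Suc n) x y"
  show "\<bar>approximant r \<psi> x - approximant r \<psi> y\<bar> \<le> K * \<rho> ^ n"
  proof (cases "r \<le> n")
    case True
    then have "word x 0 r = word y 0 r"
      using agree_mono[OF xy] by (simp add: word_eq_iff)
    then show ?thesis
      using K_pos rho_pos by (simp add: approximant_def)
  next
    case False
    obtain x' where x': "x' \<in> cylinder (word x 0 r)" "approximant r \<psi> x = \<psi> x'"
      using approximant_attained[OF cont] by metis
    obtain y' where y': "y' \<in> cylinder (word y 0 r)" "approximant r \<psi> y = \<psi> y'"
      using approximant_attained[OF cont] by metis
    have "agree (Suc n) x' x" "agree (Suc n) y' y"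
      using x'(1) y'(1) False by (auto simp: agree_cylinder intro: agree_mono)
    then have "agree (Suc n) x' y'"
      using xy by (blast intro: agree_trans agree_sym)
    then show ?thesis
      unfolding x'(2) y'(2) by (rule hoelder)
  qed
qed

lemma approximant_tendsto:
  assumes cont: "continuous_map seq_topology euclideanreal \<psi>"
  shows "(\<lambda>r. approximant r \<psi> x) \<longlonglongrightarrow> \<psi> x"
proof -
  have 1: "\<bar>approximant r \<psi> x - \<psi> x\<bar> \<le> K * \<rho> ^ r" for r
  proof -
    obtain x' where "x' \<in> cylinder (word x 0 r)" "approximant r \<psi> x = \<psi> x'"
      using approximant_attained[OF cont] by metis
    then show ?thesis
      using hoelder[of r x' x] by (simp add: agree_cylinder)
  qed
  have 2: "(\<lambda>r. K * \<rho> ^ r) \<longlonglongrightarrow> 0"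
    using rho_pos rho_less_1 by (intro tendsto_mult_right_zero LIMSEQ_realpow_zero) auto
  show ?thesis
    by (rule LIM_zero_cancel, rule Lim_null_comparison[OF _ 2]) (simp add: 1)
qed

end

text \<open>Surjectivity makes the fibres nonempty, so they may serve as the sets in
  \<open>p\<close>, and \<open>p_ratio\<close> becomes the ratio bound for the image
  measure.\<close>

lemma (in hoelder_transfer)
  fixes \<pi> :: "'a \<Rightarrow> 'b" and \<mu> :: "'a sequence measure"
  assumes surj: "surj \<pi>" and gibbs: "gibbs_measure \<psi> \<mu>"
  shows measure_pushforward_eq_p:
      "measure (pushforward \<pi> \<mu>) (cylinder v) = p (map (\<lambda>b. \<pi> -` {b}) v)"
    and ratio_words_pushforward: "ratio_words (\<lambda>v. measure (pushforward \<pi> \<mu>) (cylinder v)) D \<theta>"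
proof -
  have \<mu>: "prob_space \<mu>" "sets \<mu> = sets seq_borel"
    using gibbs by (auto simp: gibbs_measure_def)
  have fibre: "\<pi> -` {b} \<noteq> {}" for b
    using surj_vimage_empty[OF surj] by blast
  then have ne: "{} \<notin> set (map (\<lambda>b. \<pi> -` {b}) v)" for v
    by auto
  show eq: "measure (pushforward \<pi> \<mu>) (cylinder v) = p (map (\<lambda>b. \<pi> -` {b}) v)" for v
    by (simp only: measure_pushforward_cylinder[OF \<mu>] gibbs_measure_set_cylinder[OF gibbs ne])
  show "ratio_words (\<lambda>v. measure (pushforward \<pi> \<mu>) (cylinder v)) D \<theta>"
    unfolding eq
  proof
    show "0 < p (map (\<lambda>b. \<pi> -` {b}) w)" for w
      by (rule p_pos[OF ne])
    show "\<bar>(ln (p (map (\<lambda>b. \<pi> -` {b}) (c # u @ v))) - ln (p (map (\<lambda>b. \<pi> -` {b}) (u @ v)))) -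
        (ln (p (map (\<lambda>b. \<pi> -` {b}) (c # u @ v'))) - ln (p (map (\<lambda>b. \<pi> -` {b}) (u @ v'))))\<bar>
        \<le> D * \<theta> ^ length u" for c u v v'
      using p_ratio[OF fibre ne ne ne, of c u v v'] by simp
  qed (simp_all add: theta_pos theta_less_1)
qed

theorem theorem3p1:
  fixes \<pi> :: "'a::finite \<Rightarrow> 'b::finite"
    and \<psi> :: "'a sequence \<Rightarrow> real"
    and \<mu> :: "'a sequence measure"
    and \<nu> :: "nat \<Rightarrow> 'a sequence measure"
  assumes "CARD('a) > CARD('b)" and "CARD('b) \<ge> 2"
    and "surj \<pi>"
    and "hoelder_potential \<psi>"
    and "gibbs_measure \<psi> \<mu>"
    and "\<And>r. gibbs_measure (approximant r \<psi>) (\<nu> r)"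
  shows "\<exists>\<phi> :: 'b sequence \<Rightarrow> real.
      gibbs_measure \<phi> (pushforward \<pi> \<mu>) \<and>
      support (pushforward \<pi> \<mu>) = UNIV \<and>
      (\<exists>c D. c > 0 \<and> D > 0 \<and> (\<forall>n. variation n \<phi> \<le> ereal (D * exp (- c * sqrt (real n))))) \<and>
      normalized \<phi> \<and>
      (\<forall>b. \<exists>L :: nat \<Rightarrow> real.
         (\<forall>r. (\<lambda>n. ln (measure (pushforward \<pi> (\<nu> r)) (cylinder (word b 0 n)) /
                       measure (pushforward \<pi> (\<nu> r)) (cylinder (word b 1 n))))
              \<longlonglongrightarrow> L r) \<and>
         L \<longlonglongrightarrow> \<phi> b) \<and>
      (locally_constant \<psi> \<longrightarrow>
         (\<exists>\<theta> C. 0 < \<theta> \<and> \<theta> < 1 \<and> C > 0 \<and> (\<forall>n. variation n \<phi> \<le> ereal (C * \<theta> ^ n))))"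
proof -
  obtain K \<rho> where K\<rho>: "K > 0" "0 < \<rho>" "\<rho> < 1" "\<And>n. variation n \<psi> \<le> ereal (K * \<rho> ^ n)"
    using assms(4) by (auto simp: hoelder_potential_def)
  interpret hoelder_transfer K \<rho> \<psi>
    by standard (use K\<rho> in \<open>auto simp: variation_le_iff word_eq_iff\<close>)
  have cont: "continuous_map seq_topology euclideanreal \<psi>"
    and \<mu>: "prob_space \<mu>" "sets \<mu> = sets seq_borel" "shift_invariant \<mu>"
    using assms(5) by (auto simp: gibbs_measure_def)
  interpret r: hoelder_transfer K \<rho> "approximant r \<psi>" for r
    by (rule hoelder_transfer_approximant[OF cont])
  let ?P = "\<lambda>v. measure (pushforward \<pi> \<mu>) (cylinder v)"
  let ?Pr = "\<lambda>r v. measure (pushforward \<pi> (\<nu> r)) (cylinder v)"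
  interpret P: ratio_words ?P D \<theta>
    by (rule ratio_words_pushforward[OF assms(3,5)])
  interpret Pr: ratio_words "?Pr r" D \<theta> for r
    by (rule r.ratio_words_pushforward[OF assms(3,6)])
  note push = prob_space_pushforward[OF \<mu>(1,2), of \<pi>] sets_pushforward[OF \<mu>(1,2), of \<pi>]
    shift_invariant_pushforward[OF \<mu>, of \<pi>]
  interpret push: invariant_words ?P
    by (rule invariant_words_measure[OF push])
  have variation: "variation n P.\<phi> \<le> ereal (D * \<theta> ^ n)" for n
    unfolding variation_le_iff using P.phi_variation by blast
  have "gibbs_measure P.\<phi> (pushforward \<pi> \<mu>)"
    unfolding gibbs_measure_def Let_def
  proof (intro conjI push P.phi_continuous exI allI)
    show "1 \<le> exp (D / (1 - \<theta>))"
      using D_pos theta_less_1 by simp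
    show "1 / exp (D / (1 - \<theta>)) \<le> ?P (word a 0 n) / exp (birkhoff_sum (n + 1) P.\<phi> a - real (n + 1) * 0)"
      "?P (word a 0 n) / exp (birkhoff_sum (n + 1) P.\<phi> a - real (n + 1) * 0) \<le> exp (D / (1 - \<theta>))" for n a
      using P.P_bounds[where b = a and n = n] by (simp_all add: exp_minus inverse_eq_divide)
  qed
  moreover have "support (pushforward \<pi> \<mu>) = UNIV"
    by (rule support_eq_UNIV[OF push(1,2) P.P_pos])
  moreover have "\<exists>c D. c > 0 \<and> D > 0 \<and> (\<forall>n. variation n P.\<phi> \<le> ereal (D * exp (- c * sqrt (real n))))"
  proof (intro exI conjI allI)
    \<comment> \<open>The exponent is \<open>c = - ln \<theta>\<close>, since
      \<open>sqrt (real n) \<le> real n\<close> for natural \<open>n\<close>.\<close>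
    show "0 < - ln \<theta>"
      using theta_pos theta_less_1 by simp
    show "0 < D"
      by (rule D_pos)
    fix n
    have "sqrt (real n) \<le> real n"
      by (cases n) (auto intro: real_le_lsqrt simp: power2_eq_square)
    then have "real n * ln \<theta> \<le> sqrt (real n) * ln \<theta>"
      using theta_pos theta_less_1 by (intro mult_right_mono_neg) auto
    moreover have "\<theta> ^ n = exp (real n * ln \<theta>)"
      using theta_pos by (simp add: exp_of_nat_mult)
    ultimately have "D * \<theta> ^ n \<le> D * exp (- (- ln \<theta>) * sqrt (real n))"
      using D_pos by (simp add: mult.commute)
    then show "variation n P.\<phi> \<le> ereal (D * exp (- (- ln \<theta>) * sqrt (real n)))"
      by (intro order_trans[OF variation]) simp
  qed
  moreover have "normalized P.\<phi>"
  proof (rule ratio_words_normalized[OF P.ratio_words_axioms])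
    show "(\<Sum>w\<in>words n. ?P w) = 1" for n
      using push.q_future[of "[]" n] push.q_Nil by simp
  qed
  moreover have "\<exists>L. (\<forall>r. (\<lambda>n. ln (?Pr r (word b 0 n) / ?Pr r (word b 1 n))) \<longlonglongrightarrow> L r) \<and> L \<longlonglongrightarrow> P.\<phi> b" for b
  proof (intro exI conjI allI)
    show "(\<lambda>n. ln (?Pr r (word b 0 n) / ?Pr r (word b 1 n))) \<longlonglongrightarrow> Pr.\<phi> r b" for r
      using Pr.R_tendsto[of r b] by (simp add: Pr.R_def)
    have lim: "(\<lambda>r. ?Pr r v) \<longlonglongrightarrow> ?P v" for v
    proof -
      have "{} \<notin> set (map (\<lambda>b. \<pi> -` {b}) v)"
        using surj_vimage_empty[OF assms(3)] by auto
      then show ?thesis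
        unfolding measure_pushforward_eq_p[OF assms(3,5)] r.measure_pushforward_eq_p[OF assms(3,6)]
        by (intro p_tendsto hoelder_transfer_approximant approximant_tendsto cont)
    qed
    show "(\<lambda>r. Pr.\<phi> r b) \<longlonglongrightarrow> P.\<phi> b"
    \<comment> \<open>For a fixed word length \<open>k\<close> the ratios converge in
      \<open>r\<close>; the error \<open>D * \<theta> ^ k\<close> of stopping at \<open>k\<close>
      does not depend on \<open>r\<close>.\<close>
    proof (rule tendsto_uniform_rate)
      show "(\<lambda>k. D * \<theta> ^ k) \<longlonglongrightarrow> 0"
        using theta_pos theta_less_1 by (intro tendsto_mult_right_zero LIMSEQ_realpow_zero) auto
      show "(\<lambda>r. Pr.R r k b) \<longlonglongrightarrow> P.R k b" for k
        unfolding Pr.R_def P.R_def using P.P_pos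
        by (intro tendsto_ln tendsto_divide lim) (auto simp: less_imp_neq[symmetric])
    qed (rule Pr.R_rate P.R_rate)+
  qed
  moreover have "\<exists>\<theta> C. 0 < \<theta> \<and> \<theta> < 1 \<and> C > 0 \<and> (\<forall>n. variation n P.\<phi> \<le> ereal (C * \<theta> ^ n))"
    using theta_pos theta_less_1 D_pos variation by blast
  ultimately show ?thesis
    by blast
qed

end
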